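(* Let $f:\mathbb{R}^d\to\mathbb{R}$ be continuously differentiable, convex and $L$-smooth, i.e. $\|\nabla f(x)-\nabla f(y)\|\le L\|x-y\|$ for all $x,y\in\mathbb{R}^d$, and suppose $f$ has a minimizer; write $f^*:=\min_{x\in\mathbb{R}^d}f(x)$. Let $\nabla f(x;\xi)$ be an unbiased stochastic gradient of $f$ such that, for some constants $A,B,C\ge 0$, $$\mathbb{E}\big[\|\nabla f(x;\xi)\|^2\big]\le A(f(x)-f^* )+B\|\nabla f(x)\|^2+C\qquad\text{for all }x\in\mathbb{R}^d .$$ Let $\varepsilon\in(0,\frac13)$, let the step sizes be $\alpha_t=\Theta\big(\frac{1}{t^{\frac23+\varepsilon}}\big)$, and let $\beta\in[0,1)$. Let $\{x_t\}$ be generated, with $g_t=\nabla f(x_t;\xi_t)$ and $t\ge1$, by any one of the following methods: (SGD) $x_{t+1}=x_t-\alpha_tg_t$; (SHB) $x_{t+1}=x_t-\alpha_tg_t+\beta(x_t-x_{t-1})$; (SNAG) $y_{t+1}=x_t-\alpha_tg_t,\quad x_{t+1}=y_{t+1}+\beta(y_{t+1}-y_t)$. Then, for each of these methods, almost surely $x_t\to x_*$ for some (possibly random) $x_*$ with $f(x_* )=f^*$, and almost surely $$f(x_t)-f^*=O\Big(\frac{1}{t^{\frac13-\varepsilon}}\Big)\quad\text{as } t\to\infty.$$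
   Context: $\|\cdot\|$ is the Euclidean norm. $\xi$ is a random element and $\nabla f(x;\xi)$ (jointly measurable in $(x,\xi)$) is a stochastic gradient: it is unbiased, $\mathbb{E}[\nabla f(x;\xi)]=\nabla f(x)$ for every fixed $x\in\mathbb{R}^d$ (it is not required to be the gradient of anything). The samples $\xi_1,\xi_2,\dots$ are i.i.d. copies of $\xi$, and the initial points ($x_1\in\mathbb{R}^d$ for SGD; $x_0,x_1\in\mathbb{R}^d$ for SHB; $x_1,y_1\in\mathbb{R}^d$ for SNAG) are arbitrary and deterministic; thus $\xi_t$ is independent of all iterates up to $x_t$. The step sizes and $\beta$ are deterministic. $\alpha_t=\Theta(t^{-s})$ means there are constants $\eta_1,\eta_2>0$ with $\eta_1t^{-s}\le\alpha_t\le\eta_2t^{-s}$ for all $t\ge1$. "$Y_t=O(r_t)$ almost surely" means $\sup_t Y_t/r_t<\infty$ with probability one (the constant may be random). *)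

theory Defs
  imports "HOL-Probability.Probability"
begin

definition min_value :: "('a \<Rightarrow> real) \<Rightarrow> real" where
  "min_value f = (LEAST v. v \<in> range f)"

definition theta_power :: "(nat \<Rightarrow> real) \<Rightarrow> real \<Rightarrow> bool" where
  "theta_power \<alpha> s \<longleftrightarrow>
     (\<exists>\<eta>\<^sub>1>0. \<exists>\<eta>\<^sub>2>0. \<forall>t\<ge>1.
        \<eta>\<^sub>1 * real t powr (- s) \<le> \<alpha> t \<and> \<alpha> t \<le> \<eta>\<^sub>2 * real t powr (- s))"

text \<open>
  Time starts at 1, and the bound on the quotient may depend on the outcome.
\<close>

definition as_bigo :: "'w measure \<Rightarrow> (nat \<Rightarrow> 'w \<Rightarrow> real) \<Rightarrow> (nat \<Rightarrow> real) \<Rightarrow> bool" where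
  "as_bigo M Y r \<longleftrightarrow> (AE \<omega> in M. bdd_above ((\<lambda>t. Y t \<omega> / r t) ` {1..}))"

text \<open>
  In the three methods \<open>G\<close> is the stochastic gradient, \<open>\<xi>s t\<close> the sample used
  at time \<open>t \<ge> 1\<close> and \<open>x\<close> the sequence of iterates. The initial points are arbitrary but
  do not depend on the outcome. Values of the sequences at times before the initial ones
  are irrelevant.
\<close>

definition sgd ::
  "'w measure \<Rightarrow> ('a::euclidean_space \<Rightarrow> 'b \<Rightarrow> 'a) \<Rightarrow> (nat \<Rightarrow> 'w \<Rightarrow> 'b) \<Rightarrow> (nat \<Rightarrow> real) \<Rightarrow>
     (nat \<Rightarrow> 'w \<Rightarrow> 'a) \<Rightarrow> bool" where
  "sgd M G \<xi>s \<alpha> x \<longleftrightarrow>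
     (\<exists>a. \<forall>\<omega>\<in>space M. x 1 \<omega> = a) \<and>
     (\<forall>t\<ge>1. \<forall>\<omega>\<in>space M. x (t + 1) \<omega> = x t \<omega> - \<alpha> t *\<^sub>R G (x t \<omega>) (\<xi>s t \<omega>))"

definition shb ::
  "'w measure \<Rightarrow> ('a::euclidean_space \<Rightarrow> 'b \<Rightarrow> 'a) \<Rightarrow> (nat \<Rightarrow> 'w \<Rightarrow> 'b) \<Rightarrow> (nat \<Rightarrow> real) \<Rightarrow> real \<Rightarrow>
     (nat \<Rightarrow> 'w \<Rightarrow> 'a) \<Rightarrow> bool" where
  "shb M G \<xi>s \<alpha> \<beta> x \<longleftrightarrow>
     (\<exists>a. \<forall>\<omega>\<in>space M. x 0 \<omega> = a) \<and>
     (\<exists>a. \<forall>\<omega>\<in>space M. x 1 \<omega> = a) \<and>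
     (\<forall>t\<ge>1. \<forall>\<omega>\<in>space M.
        x (t + 1) \<omega> =
          x t \<omega> - \<alpha> t *\<^sub>R G (x t \<omega>) (\<xi>s t \<omega>) + \<beta> *\<^sub>R (x t \<omega> - x (t - 1) \<omega>))"

definition snag ::
  "'w measure \<Rightarrow> ('a::euclidean_space \<Rightarrow> 'b \<Rightarrow> 'a) \<Rightarrow> (nat \<Rightarrow> 'w \<Rightarrow> 'b) \<Rightarrow> (nat \<Rightarrow> real) \<Rightarrow> real \<Rightarrow>
     (nat \<Rightarrow> 'w \<Rightarrow> 'a) \<Rightarrow> bool" where
  "snag M G \<xi>s \<alpha> \<beta> x \<longleftrightarrow>
     (\<exists>y :: nat \<Rightarrow> 'w \<Rightarrow> 'a.
        (\<exists>a. \<forall>\<omega>\<in>space M. x 1 \<omega> = a) \<and>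
        (\<exists>a. \<forall>\<omega>\<in>space M. y 1 \<omega> = a) \<and>
        (\<forall>t\<ge>1. \<forall>\<omega>\<in>space M.
           y (t + 1) \<omega> = x t \<omega> - \<alpha> t *\<^sub>R G (x t \<omega>) (\<xi>s t \<omega>) \<and>
           x (t + 1) \<omega> = y (t + 1) \<omega> + \<beta> *\<^sub>R (y (t + 1) \<omega> - y t \<omega>)))"

end

theory Submission
  imports Defs
begin

text \<open>
  With \<open>\<kappa> = 1 / (1 - \<beta>)\<close>, each method is a plain stochastic gradient recursion
  \<open>z\<^sub>t\<^sub>+\<^sub>1 = z\<^sub>t - \<kappa> \<alpha>\<^sub>t g\<^sub>t\<close> for an auxiliary sequence \<open>z\<^sub>t = x\<^sub>t + p\<^sub>t\<close> whose displacement contracts,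
  \<open>p\<^sub>t\<^sub>+\<^sub>1 = \<beta> p\<^sub>t - c \<alpha>\<^sub>t g\<^sub>t\<close>. For a minimizer \<open>y\<close>,
  the Lyapunov function \<open>|z - y|\<^sup>2 + (\<kappa>\<^sup>2 + \<kappa>) |p|\<^sup>2\<close> decreases in conditional mean by
  \<open>|p|\<^sup>2 + \<alpha>\<^sub>t (f x - f\<^sup>*)\<close> up to a summable error \<open>O(\<alpha>\<^sub>t\<^sup>2)\<close>, so this dissipation is summable in mean.
  Weighting the objective by \<open>t\<^sup>q\<close> with \<open>q = 1/3 - \<epsilon>\<close> costs \<open>t\<close> to the power \<open>q - 1\<close>, which is comparable to \<open>\<alpha>\<^sub>t\<close>,
  times the gap, that is, a multiple of the dissipation, and \<open>t\<^sup>q \<alpha>\<^sub>t\<^sup>2\<close> is still summable. Hence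
  \<open>t\<^sup>q (f z - f\<^sup>* + |p|\<^sup>2)\<close> is an almost supermartingale as well. Both processes converge
  almost surely by Doob's upcrossing argument; the second one gives the rate, and the first one,
  for a countable dense set of minimizers \<open>y\<close>, gives convergence of the iterates.
\<close>

section \<open>Almost supermartingales\<close>

text \<open>The position of a trader who buys at or below \<open>a\<close> and sells at or above
  \<open>b\<close>. It is settled by \<open>u 0\<close>, ..., \<open>u n\<close>, so it is a
  predictable multiplier for the increment from \<open>n\<close> to \<open>Suc n\<close>;
  \<open>upcrossings\<close> counts the completed sales.\<close>

primrec holding :: "real \<Rightarrow> real \<Rightarrow> (nat \<Rightarrow> real) \<Rightarrow> nat \<Rightarrow> bool" where
  "holding a b u 0 \<longleftrightarrow> u 0 \<le> a"
| "holding a b u (Suc n) \<longleftrightarrow> (if holding a b u n then u (Suc n) < b else u (Suc n) \<le> a)"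

primrec upcrossings :: "real \<Rightarrow> real \<Rightarrow> (nat \<Rightarrow> real) \<Rightarrow> nat \<Rightarrow> nat" where
  "upcrossings a b u 0 = 0"
| "upcrossings a b u (Suc n) =
     upcrossings a b u n + of_bool (holding a b u n \<and> b \<le> u (Suc n))"

lemma mono_upcrossings: "mono (upcrossings a b u)"
  by (auto simp: mono_iff_le_Suc)

text \<open>While a share is held, the trading gain includes the unrealised \<open>u n - a\<close>.\<close>

lemma upcrossings_le_gain:
  assumes "\<And>n. 0 \<le> u n" "0 \<le> a" "a < b"
  shows "(b - a) * upcrossings a b u n - a
           \<le> (\<Sum>k<n. of_bool (holding a b u k) * (u (Suc k) - u k))"
proof -
  have "(b - a) * upcrossings a b u n + of_bool (holding a b u n) * (u n - a)
           \<le> (\<Sum>k<n. of_bool (holding a b u k) * (u (Suc k) - u k))"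
  proof (induction n)
    case (Suc n)
    then show ?case
      using assms(3) by (auto simp: algebra_simps of_bool_def split: if_splits)
  qed auto
  \<comment> \<open>An open position can lose at most its purchase level, because \<open>u\<close>
    never drops below 0.\<close>
  moreover have "- a \<le> of_bool (holding a b u n) * (u n - a)"
    using assms by (auto simp: of_bool_def)
  ultimately show ?thesis by linarith
qed

text \<open>A bounded monotone count of integers is eventually constant. After the last sale, a
  visit to level \<open>a\<close> opens a position that can never be closed again, so the sequence
  would stay below \<open>b\<close> forever.\<close>

lemma upcrossings_unbounded:
  assumes lo: "\<exists>\<^sub>F n in sequentially. u n \<le> a" and hi: "\<exists>\<^sub>F n in sequentially. b \<le> u n"
    and ab: "a < b"
  shows "\<exists>n. K < upcrossings a b u n"
proof (rule ccontr)
  assume "\<not> ?thesis"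
  then have bdd: "upcrossings a b u n \<le> K" for n
    by (simp add: not_less)
  define S where "S = Max (range (upcrossings a b u))"
  have fin: "finite (range (upcrossings a b u))"
    by (rule finite_subset[of _ "{..K}"]) (use bdd in auto)
  have "S \<in> range (upcrossings a b u)"
    unfolding S_def by (rule Max_in[OF fin]) simp
  then obtain N where N: "upcrossings a b u N = S"
    by (metis imageE)
  have const: "upcrossings a b u n = S" if "N \<le> n" for n
  proof (rule antisym)
    show "upcrossings a b u n \<le> S"
      unfolding S_def by (rule Max_ge[OF fin]) simp
    show "S \<le> upcrossings a b u n"
      using monoD[OF mono_upcrossings that, of a b u] N by simp
  qed
  have below: "u (Suc n) < b" if "N \<le> n" "holding a b u n" for n
    using const[of n] const[of "Suc n"] that by (auto simp: not_le[symmetric])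
  obtain m where m: "Suc N \<le> m" "u m \<le> a"
    using lo unfolding frequently_sequentially by blast
  have hm: "holding a b u m"
    using m ab by (cases m) auto
  have "holding a b u n" if "m \<le> n" for n
    using that
  proof (induction rule: dec_induct)
    case (step n)
    then show ?case using below[of n] m by simp
  qed (fact hm)
  then have later: "u (Suc n) < b" if "m \<le> n" for n
    using below[of n] that m by simp
  obtain n where n: "Suc m \<le> n" "b \<le> u n"
    using hi unfolding frequently_sequentially by blast
  then obtain k where "n = Suc k" "m \<le> k"
    by (cases n) auto
  with later[of k] n show False
    by simp
qed

text \<open>If the lower limit were smaller than the upper one, two rationals between them would be
  crossed infinitely often. Rational levels suffice, which leaves countably many exceptional events
  in the almost sure version.\<close>

lemma convergent_if_no_oscillation:
  fixes u :: "nat \<Rightarrow> real"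
  assumes nonneg: "\<And>n. 0 \<le> u n"
    and R: "\<exists>\<^sub>F n in sequentially. u n \<le> R"
    and no_osc: "\<And>a b. a \<in> \<rat> \<Longrightarrow> b \<in> \<rat> \<Longrightarrow> 0 \<le> a \<Longrightarrow> a < b \<Longrightarrow>
      \<not> ((\<exists>\<^sub>F n in sequentially. u n \<le> a) \<and> (\<exists>\<^sub>F n in sequentially. b \<le> u n))"
  shows "convergent u"
proof -
  \<comment> \<open>Level \<open>a\<close> is visited infinitely often, so absence of oscillation
    between \<open>a\<close> and \<open>a + 1\<close> already bounds \<open>u\<close> eventually;
    this makes both limits finite.\<close>
  obtain a where a: "a \<in> \<rat>" "max R 0 < a"
    using Rats_dense_in_real[of "max R 0" "max R 0 + 1"] by auto
  have "\<exists>\<^sub>F n in sequentially. u n \<le> a"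
    using R by (rule frequently_mono[rotated]) (use a in auto)
  with no_osc[of a "a + 1"] a have "\<forall>\<^sub>F n in sequentially. \<not> a + 1 \<le> u n"
    by (auto simp: not_frequently)
  then have bd: "\<forall>\<^sub>F n in sequentially. u n \<le> a + 1"
    by eventually_elim auto
  have up: "limsup (\<lambda>n. ereal (u n)) \<le> ereal (a + 1)"
    using bd by (intro Limsup_bounded) (auto elim: eventually_mono)
  have low: "0 \<le> liminf (\<lambda>n. ereal (u n))"
    by (intro Liminf_bounded) (auto simp: nonneg)
  have le: "liminf (\<lambda>n. ereal (u n)) \<le> limsup (\<lambda>n. ereal (u n))"
    by (intro Liminf_le_Limsup) auto
  obtain l where l: "liminf (\<lambda>n. ereal (u n)) = ereal l" "0 \<le> l"
    using low le up by (cases "liminf (\<lambda>n. ereal (u n))") auto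
  obtain L where L: "limsup (\<lambda>n. ereal (u n)) = ereal L"
    using low le up by (cases "limsup (\<lambda>n. ereal (u n))") auto
  have "L \<le> l"
  proof (rule ccontr)
    assume "\<not> L \<le> l"
    then obtain p where p: "p \<in> \<rat>" "l < p" "p < L"
      using Rats_dense_in_real[of l L] by auto
    then obtain q where q: "q \<in> \<rat>" "p < q" "q < L"
      using Rats_dense_in_real[of p L] by auto
    have "\<exists>\<^sub>F n in sequentially. u n \<le> p"
    proof (rule ccontr)
      assume "\<not> ?thesis"
      then have "\<forall>\<^sub>F n in sequentially. ereal p \<le> ereal (u n)"
        by (auto simp: not_frequently elim: eventually_mono)
      then have "ereal p \<le> liminf (\<lambda>n. ereal (u n))"
        by (rule Liminf_bounded)
      with l p show False by simp
    qed
    moreover have "\<exists>\<^sub>F n in sequentially. q \<le> u n"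
    proof (rule ccontr)
      assume "\<not> ?thesis"
      then have "\<forall>\<^sub>F n in sequentially. ereal (u n) \<le> ereal q"
        by (auto simp: not_frequently elim: eventually_mono)
      then have "limsup (\<lambda>n. ereal (u n)) \<le> ereal q"
        by (rule Limsup_bounded)
      with L q show False by simp
    qed
    ultimately show False
      using no_osc[of p q] p q l by auto
  qed
  with le l L have "L = l" by simp
  then have "(\<lambda>n. ereal (u n)) \<longlonglongrightarrow> ereal l"
    using l L by (intro Liminf_eq_Limsup) auto
  then show ?thesis
    by (auto simp: convergent_def)
qed

text \<open>Doob's upcrossing argument. The hypothesis \<open>decrease\<close> is the integrated
  form of a drift condition: it holds whenever the conditional mean of \<open>U (Suc n)\<close>
  given \<open>F n\<close> is at most \<open>U n\<close> plus a nonnegative error of mean at most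
  \<open>w n\<close>.\<close>

theorem (in prob_space) almost_supermartingale_convergent:
  fixes F :: "nat \<Rightarrow> 'a measure" and U :: "nat \<Rightarrow> 'a \<Rightarrow> real" and w :: "nat \<Rightarrow> real"
  assumes sub: "\<And>n. subalgebra M (F n)"
    and filtration: "\<And>n. sets (F n) \<subseteq> sets (F (Suc n))"
    and adapted: "\<And>n. U n \<in> borel_measurable (F n)"
    and nonneg: "\<And>n \<omega>. 0 \<le> U n \<omega>"
    and integrable: "\<And>n. integrable M (U n)"
    and decrease: "\<And>n A. A \<in> sets (F n) \<Longrightarrow>
      (\<integral>\<omega>. indicator A \<omega> * U (Suc n) \<omega> \<partial>M) \<le> (\<integral>\<omega>. indicator A \<omega> * U n \<omega> \<partial>M) + w n"
    and w: "summable w"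
  shows "AE \<omega> in M. convergent (\<lambda>n. U n \<omega>)"
proof -
  have space: "space (F n) = space M" for n
    using sub by (simp add: subalgebra_def)
  have U[measurable]: "U n \<in> borel_measurable M" for n
    using adapted sub measurable_from_subalg by blast
  have w0: "0 \<le> w n" for n
    using decrease[of "{}" n] by simp
  define W where "W = suminf w"
  have wW: "(\<Sum>k<n. w k) \<le> W" for n
    unfolding W_def using w w0 by (intro sum_le_suminf) auto

  have bounded: "(\<integral>\<omega>. U n \<omega> \<partial>M) \<le> (\<integral>\<omega>. U 0 \<omega> \<partial>M) + (\<Sum>k<n. w k)" for n
  proof (induction n)
    case (Suc n)
    have "(\<integral>\<omega>. U (Suc n) \<omega> \<partial>M) = (\<integral>\<omega>. indicator (space M) \<omega> * U (Suc n) \<omega> \<partial>M)"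
      by (intro Bochner_Integration.integral_cong) auto
    also have "\<dots> \<le> (\<integral>\<omega>. indicator (space M) \<omega> * U n \<omega> \<partial>M) + w n"
      using decrease[OF sets.top[of "F n"]] by (simp add: space)
    also have "(\<integral>\<omega>. indicator (space M) \<omega> * U n \<omega> \<partial>M) = (\<integral>\<omega>. U n \<omega> \<partial>M)"
      by (intro Bochner_Integration.integral_cong) auto
    finally show ?case using Suc by simp
  qed simp
  \<comment> \<open>Fatou's lemma: the means are bounded uniformly in \<open>n\<close>, so the lower
    limit is finite almost surely, and almost every path returns infinitely often below some level
    of its own.\<close>
  have "(\<integral>\<^sup>+\<omega>. liminf (\<lambda>n. ennreal (U n \<omega>)) \<partial>M) \<le> liminf (\<lambda>n. \<integral>\<^sup>+\<omega>. ennreal (U n \<omega>) \<partial>M)"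
    by (rule nn_integral_liminf) simp
  also have "\<dots> \<le> liminf (\<lambda>n::nat. ennreal ((\<integral>\<omega>. U 0 \<omega> \<partial>M) + W))"
  proof (intro Liminf_mono always_eventually allI)
    fix n
    show "(\<integral>\<^sup>+\<omega>. ennreal (U n \<omega>) \<partial>M) \<le> ennreal ((\<integral>\<omega>. U 0 \<omega> \<partial>M) + W)"
      using bounded[of n] wW[of n]
      by (subst nn_integral_eq_integral) (auto simp: integrable nonneg intro!: ennreal_leI)
  qed
  also have "\<dots> < \<infinity>"
    by (simp add: Liminf_const)
  finally have "AE \<omega> in M. liminf (\<lambda>n. ennreal (U n \<omega>)) \<noteq> \<infinity>"
    by (intro nn_integral_PInf_AE) auto
  moreover have "\<exists>R. \<exists>\<^sub>F n in sequentially. U n \<omega> \<le> R"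
    if fin: "liminf (\<lambda>n. ennreal (U n \<omega>)) \<noteq> \<infinity>" for \<omega>
  proof (rule ccontr)
    assume "\<not> ?thesis"
    then have "\<forall>\<^sub>F n in sequentially. ennreal R \<le> ennreal (U n \<omega>)" for R
      by (auto simp: not_frequently not_le intro!: ennreal_leI elim!: eventually_mono dest!: spec[of _ R])
    then have large: "ennreal R \<le> liminf (\<lambda>n. ennreal (U n \<omega>))" for R
      by (rule Liminf_bounded)
    obtain r where "0 \<le> r" "liminf (\<lambda>n. ennreal (U n \<omega>)) = ennreal r"
      using fin by (cases "liminf (\<lambda>n. ennreal (U n \<omega>))") auto
    with large[of "r + 1"] show False
      by simp
  qed
  ultimately have freq: "AE \<omega> in M. \<exists>R. \<exists>\<^sub>F n in sequentially. U n \<omega> \<le> R"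
    by auto

  have no_osc: "AE \<omega> in M. \<not> ((\<exists>\<^sub>F n in sequentially. U n \<omega> \<le> a) \<and> (\<exists>\<^sub>F n in sequentially. b \<le> U n \<omega>))"
    if a: "0 \<le> a" and ab: "a < b" for a b
  proof -
    \<comment> \<open>The event that a share is held after time \<open>n\<close>. It belongs to
      \<open>F n\<close>, so \<open>decrease\<close> may be tested on it, and the expected trading
      gain of each step is at most \<open>w n\<close>.\<close>
    define H where "H n = {\<omega> \<in> space M. holding a b (\<lambda>n. U n \<omega>) n}" for n
    have H: "H n \<in> sets (F n)" for n
    proof (induction n)
      case 0
      have "Measurable.pred (F 0) (\<lambda>\<omega>. U 0 \<omega> \<le> a)"
        using adapted[of 0] by measurable
      then show ?case
        by (simp add: H_def pred_def space)
    next
      case (Suc n)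
      have [measurable]: "H n \<in> sets (F (Suc n))" "U (Suc n) \<in> borel_measurable (F (Suc n))"
        using filtration Suc adapted by auto
      have "{\<omega> \<in> space (F (Suc n)). if \<omega> \<in> H n then U (Suc n) \<omega> < b else U (Suc n) \<omega> \<le> a} \<in> sets (F (Suc n))"
        by measurable
      also have "{\<omega> \<in> space (F (Suc n)). if \<omega> \<in> H n then U (Suc n) \<omega> < b else U (Suc n) \<omega> \<le> a} = H (Suc n)"
        by (auto simp: H_def space)
      finally show ?case .
    qed
    then have HM[measurable]: "H n \<in> sets M" for n
      using sub by (auto simp: subalgebra_def)
    define c where "c \<omega> n = upcrossings a b (\<lambda>n. U n \<omega>) n" for \<omega> n
    have cM[measurable]: "(\<lambda>\<omega>. indicator (space M) \<omega> * real (c \<omega> n)) \<in> borel_measurable M" for n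
    proof (induction n)
      case (Suc n)
      have "(\<lambda>\<omega>. indicator (space M) \<omega> * real (c \<omega> n) + (if \<omega> \<in> H n \<and> b \<le> U (Suc n) \<omega> then 1 else 0)) \<in> borel_measurable M"
        using Suc by measurable
      then show ?case
        by (rule measurable_cong[THEN iffD1, rotated]) (auto simp: c_def H_def)
    qed (simp add: c_def)
    have ci: "(\<integral>\<^sup>+\<omega>. ennreal (real (c \<omega> n)) \<partial>M) \<le> ennreal ((a + W) / (b - a))" for n
    proof -
      have gain: "integrable M (\<lambda>\<omega>. indicator (H k) \<omega> * U m \<omega>)" for k m
        using integrable_mult_indicator[OF HM[of k] integrable[of m]] by simp
      have le: "(b - a) * real (c \<omega> n) - a
          \<le> (\<Sum>k<n. indicator (H k) \<omega> * U (Suc k) \<omega> - indicator (H k) \<omega> * U k \<omega>)"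
        if "\<omega> \<in> space M" for \<omega>
        using upcrossings_le_gain[of "\<lambda>n. U n \<omega>" a b n] that nonneg a ab
        by (simp add: c_def H_def indicator_def of_bool_def right_diff_distrib)
      \<comment> \<open>The trading gain plus the largest possible loss \<open>a\<close>, divided by
        the profit \<open>b - a\<close> of one upcrossing. It dominates the count, and its mean is
        bounded independently of \<open>n\<close>.\<close>
      define X where "X \<omega> = ((\<Sum>k<n. indicator (H k) \<omega> * U (Suc k) \<omega> - indicator (H k) \<omega> * U k \<omega>) + a) / (b - a)" for \<omega>
      have X: "integrable M X"
        unfolding X_def using gain by auto
      have cX: "real (c \<omega> n) \<le> X \<omega>" if "\<omega> \<in> space M" for \<omega>
        using le[OF that] ab by (simp add: X_def field_simps)
      have "(\<integral>\<omega>. X \<omega> \<partial>M) = ((\<Sum>k<n. (\<integral>\<omega>. indicator (H k) \<omega> * U (Suc k) \<omega> \<partial>M) - (\<integral>\<omega>. indicator (H k) \<omega> * U k \<omega> \<partial>M)) + a) / (b - a)"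
        unfolding X_def using gain by (simp add: Bochner_Integration.integral_sum prob_space)
      also have "\<dots> \<le> ((\<Sum>k<n. w k) + a) / (b - a)"
        using decrease[OF H] ab by (intro divide_right_mono add_right_mono sum_mono) (auto simp: algebra_simps)
      also have "\<dots> \<le> (a + W) / (b - a)"
        using wW[of n] ab by (intro divide_right_mono) auto
      finally have XW: "(\<integral>\<omega>. X \<omega> \<partial>M) \<le> (a + W) / (b - a)" .
      have "(\<integral>\<^sup>+\<omega>. ennreal (real (c \<omega> n)) \<partial>M) \<le> (\<integral>\<^sup>+\<omega>. ennreal (X \<omega>) \<partial>M)"
        using cX by (intro nn_integral_mono ennreal_leI) auto
      also have "\<dots> = ennreal (\<integral>\<omega>. X \<omega> \<partial>M)"
        using cX by (intro nn_integral_eq_integral X AE_I2) (meson of_nat_0_le_iff order_trans)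
      also have "\<dots> \<le> ennreal ((a + W) / (b - a))"
        using XW by (rule ennreal_leI)
      finally show ?thesis .
    qed
    have mono_c: "c \<omega> m \<le> c \<omega> n" if "m \<le> n" for \<omega> m n
      unfolding c_def by (rule monoD[OF mono_upcrossings that])
    \<comment> \<open>Monotone convergence passes the uniform bound to the total number of
      upcrossings, which is therefore finite almost surely.\<close>
    have "(\<integral>\<^sup>+\<omega>. (SUP n. ennreal (indicator (space M) \<omega> * real (c \<omega> n))) \<partial>M)
        = (SUP n. \<integral>\<^sup>+\<omega>. ennreal (indicator (space M) \<omega> * real (c \<omega> n)) \<partial>M)"
    proof (rule nn_integral_monotone_convergence_SUP)
      show "incseq (\<lambda>n \<omega>. ennreal (indicator (space M) \<omega> * real (c \<omega> n)))"
        by (intro incseq_SucI le_funI ennreal_leI mult_left_mono of_nat_mono mono_c) auto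
    qed measurable
    also have "\<dots> \<le> ennreal ((a + W) / (b - a))"
    proof (intro SUP_least)
      fix n
      have "(\<integral>\<^sup>+\<omega>. ennreal (indicator (space M) \<omega> * real (c \<omega> n)) \<partial>M) = (\<integral>\<^sup>+\<omega>. ennreal (real (c \<omega> n)) \<partial>M)"
        by (intro nn_integral_cong) auto
      then show "(\<integral>\<^sup>+\<omega>. ennreal (indicator (space M) \<omega> * real (c \<omega> n)) \<partial>M) \<le> ennreal ((a + W) / (b - a))"
        using ci[of n] by simp
    qed
    also have "\<dots> < \<infinity>" by simp
    finally have "AE \<omega> in M. (SUP n. ennreal (indicator (space M) \<omega> * real (c \<omega> n))) \<noteq> \<infinity>"
      by (intro nn_integral_PInf_AE) auto
    then show ?thesis
    proof (rule AE_mp, intro AE_I2 impI notI)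
      fix \<omega>
      assume \<omega>: "\<omega> \<in> space M" and fin: "(SUP n. ennreal (indicator (space M) \<omega> * real (c \<omega> n))) \<noteq> \<infinity>"
        and osc: "(\<exists>\<^sub>F n in sequentially. U n \<omega> \<le> a) \<and> (\<exists>\<^sub>F n in sequentially. b \<le> U n \<omega>)"
      obtain r where r: "0 \<le> r" "(SUP n. ennreal (indicator (space M) \<omega> * real (c \<omega> n))) = ennreal r"
        using fin by (cases "(SUP n. ennreal (indicator (space M) \<omega> * real (c \<omega> n)))") auto
      have le: "real (c \<omega> n) \<le> r" for n
      proof -
        have "ennreal (indicator (space M) \<omega> * real (c \<omega> n)) \<le> ennreal r"
          unfolding r(2)[symmetric] by (rule SUP_upper) simp
        then show ?thesis
          using \<omega> r by simp
      qed
      obtain n where "nat \<lceil>r\<rceil> < c \<omega> n"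
        using upcrossings_unbounded[of "\<lambda>n. U n \<omega>" a b "nat \<lceil>r\<rceil>"] osc ab by (auto simp: c_def)
      then have "real (nat \<lceil>r\<rceil>) < real (c \<omega> n)"
        by simp
      with le[of n] real_nat_ceiling_ge[of r] show False
        by linarith
    qed
  qed
  \<comment> \<open>Countably many rational pairs share a single null set.\<close>
  have "countable {(a, b). a \<in> \<rat> \<and> b \<in> \<rat> \<and> (0::real) \<le> a \<and> a < b}"
    by (rule countable_subset[of _ "\<rat> \<times> \<rat>"]) (auto simp: countable_rat)
  then have "AE \<omega> in M. \<forall>(a, b)\<in>{(a, b). a \<in> \<rat> \<and> b \<in> \<rat> \<and> (0::real) \<le> a \<and> a < b}.
      \<not> ((\<exists>\<^sub>F n in sequentially. U n \<omega> \<le> a) \<and> (\<exists>\<^sub>F n in sequentially. b \<le> U n \<omega>))"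
    using no_osc by (subst AE_ball_countable) auto
  with freq show ?thesis
  proof eventually_elim
    case (elim \<omega>)
    then obtain R where R: "\<exists>\<^sub>F n in sequentially. U n \<omega> \<le> R"
      by blast
    show ?case
      by (rule convergent_if_no_oscillation[OF nonneg R]) (use elim(2) in blast)
  qed
qed

section \<open>Fresh samples\<close>

text \<open>The sigma-algebra generated by \<open>X 0\<close>, ..., \<open>X (n - 1)\<close>. As a
  pullback from a product space, it presents each past event as the preimage of one set under the
  tuple of samples, the form in which independence of disjoint index blocks applies.\<close>

definition past :: "'w measure \<Rightarrow> 'b measure \<Rightarrow> (nat \<Rightarrow> 'w \<Rightarrow> 'b) \<Rightarrow> nat \<Rightarrow> 'w measure" where
  "past M N X n =
     vimage_algebra (space M) (\<lambda>\<omega>. restrict (\<lambda>i. X i \<omega>) {..<n}) (PiM {..<n} (\<lambda>_. N))"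

context
  fixes M :: "'w measure" and N :: "'b measure" and X :: "nat \<Rightarrow> 'w \<Rightarrow> 'b"
  assumes X: "\<And>i. X i \<in> M \<rightarrow>\<^sub>M N"
begin

lemma space_past[simp]: "space (past M N X n) = space M"
  by (simp add: past_def)

lemma subalgebra_past: "subalgebra M (past M N X n)"
proof -
  have "(\<lambda>\<omega>. restrict (\<lambda>i. X i \<omega>) {..<n}) \<in> M \<rightarrow>\<^sub>M PiM {..<n} (\<lambda>_. N)"
    by (rule measurable_restrict) (rule X)
  from sets_image_in_sets[OF refl this] show ?thesis
    by (simp add: subalgebra_def past_def)
qed

lemma measurable_past: "i < n \<Longrightarrow> X i \<in> past M N X n \<rightarrow>\<^sub>M N"
proof -
  assume i: "i < n"
  have "(\<lambda>\<omega>. restrict (\<lambda>i. X i \<omega>) {..<n}) \<in> past M N X n \<rightarrow>\<^sub>M PiM {..<n} (\<lambda>_. N)"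
    unfolding past_def
    by (rule measurable_vimage_algebra1) (auto simp: space_PiM PiE_def extensional_def intro: measurable_space[OF X])
  from measurable_compose[OF this measurable_component_singleton[of i]] i
  show ?thesis by simp
qed

lemma past_mono: "sets (past M N X n) \<subseteq> sets (past M N X (Suc n))"
proof -
  have "(\<lambda>\<omega>. restrict (\<lambda>i. X i \<omega>) {..<n}) \<in> past M N X (Suc n) \<rightarrow>\<^sub>M PiM {..<n} (\<lambda>_. N)"
    by (rule measurable_restrict) (simp add: measurable_past)
  from sets_image_in_sets[OF space_past this] show ?thesis
    by (simp add: past_def[of M N X n])
qed

lemma measurable_past_Suc: "Y \<in> past M N X n \<rightarrow>\<^sub>M S \<Longrightarrow> Y \<in> past M N X (Suc n) \<rightarrow>\<^sub>M S"
  using measurable_mono[OF order_refl refl past_mono] by auto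

lemma measurable_past_imp: "Y \<in> past M N X n \<rightarrow>\<^sub>M S \<Longrightarrow> Y \<in> M \<rightarrow>\<^sub>M S"
  by (rule measurable_from_subalg[OF subalgebra_past])

end

text \<open>An event about \<open>Y\<close> is an event about the tuple of earlier samples, and this
  tuple is independent of \<open>X n\<close> because the index blocks \<open>{..<n}\<close> and
  \<open>{n}\<close> are disjoint. Agreement on rectangles determines the joint law.\<close>

lemma (in prob_space) distr_past_fresh_sample:
  assumes indep: "indep_vars (\<lambda>_. N) X UNIV" and Y: "Y \<in> past M N X n \<rightarrow>\<^sub>M S"
  shows "distr M (S \<Otimes>\<^sub>M N) (\<lambda>\<omega>. (Y \<omega>, X n \<omega>)) = distr M S Y \<Otimes>\<^sub>M distr M N (X n)"
proof (rule pair_measure_eqI[symmetric])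
  have X[measurable]: "\<And>i. X i \<in> M \<rightarrow>\<^sub>M N"
    using indep by (auto simp: indep_vars_def)
  have YM[measurable]: "Y \<in> M \<rightarrow>\<^sub>M S"
    by (rule measurable_past_imp[OF X Y])
  show "sigma_finite_measure (distr M S Y)" "sigma_finite_measure (distr M N (X n))"
    by (intro prob_space_imp_sigma_finite prob_space_distr; measurable)+
  show "sets (distr M S Y \<Otimes>\<^sub>M distr M N (X n)) = sets (distr M (S \<Otimes>\<^sub>M N) (\<lambda>\<omega>. (Y \<omega>, X n \<omega>)))"
    by (simp cong: sets_pair_measure_cong)
  fix A B assume "A \<in> sets (distr M S Y)" "B \<in> sets (distr M N (X n))"
  then have A: "A \<in> sets S" and B: "B \<in> sets N"
    by auto
  let ?H = "\<lambda>\<omega>. restrict (\<lambda>i. X i \<omega>) {..<n}" and ?R = "\<lambda>\<omega>. restrict (\<lambda>i. X i \<omega>) {n}"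
  have ind: "indep_var (PiM {..<n} (\<lambda>_. N)) ?H (PiM {n} (\<lambda>_. N)) ?R"
    by (rule indep_var_restrict[OF indep]) auto
  have "?H \<in> space M \<rightarrow> space (PiM {..<n} (\<lambda>_. N))"
    by (auto simp: space_PiM PiE_def extensional_def intro: measurable_space[OF X])
  moreover have "Y -` A \<inter> space M \<in> sets (past M N X n)"
    using measurable_sets[OF Y A] by (simp add: space_past[OF X])
  ultimately obtain A' where A': "A' \<in> sets (PiM {..<n} (\<lambda>_. N))" "Y -` A \<inter> space M = ?H -` A' \<inter> space M"
    unfolding past_def by (auto simp: sets_vimage_algebra2)
  \<comment> \<open>Independence is available for tuples, so \<open>B\<close> is lifted to tuples
    with the single index \<open>n\<close>.\<close>
  define B' where "B' = (\<lambda>f. f n) -` B \<inter> space (PiM {n} (\<lambda>_. N))"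
  have B': "B' \<in> sets (PiM {n} (\<lambda>_. N))"
    unfolding B'_def using B by measurable
  have RB: "?R -` B' \<inter> space M = X n -` B \<inter> space M"
    by (auto simp: B'_def space_PiM PiE_def extensional_def intro: measurable_space[OF X])
  have "prob ((\<lambda>\<omega>. (?H \<omega>, ?R \<omega>)) -` (A' \<times> B') \<inter> space M) = prob (?H -` A' \<inter> space M) * prob (?R -` B' \<inter> space M)"
    by (rule indep_varD[OF ind A'(1) B'])
  also have "(\<lambda>\<omega>. (?H \<omega>, ?R \<omega>)) -` (A' \<times> B') \<inter> space M = (\<lambda>\<omega>. (Y \<omega>, X n \<omega>)) -` (A \<times> B) \<inter> space M"
    using A'(2) RB by blast
  also have "prob (?H -` A' \<inter> space M) * prob (?R -` B' \<inter> space M) = prob (Y -` A \<inter> space M) * prob (X n -` B \<inter> space M)"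
    by (simp only: A'(2) RB)
  finally show "emeasure (distr M S Y) A * emeasure (distr M N (X n)) B
      = emeasure (distr M (S \<Otimes>\<^sub>M N) (\<lambda>\<omega>. (Y \<omega>, X n \<omega>))) (A \<times> B)"
    using A B by (simp add: emeasure_distr emeasure_eq_measure ennreal_mult)
qed

text \<open>Tonelli's theorem for the product law, with the law of the fresh sample replaced by the
  common law of \<open>\<xi>\<close>.\<close>

lemma (in prob_space) nn_integral_past_fresh_sample:
  assumes indep: "indep_vars (\<lambda>_. N) X UNIV" and Y: "Y \<in> past M N X n \<rightarrow>\<^sub>M S"
    and law: "distr M N (X n) = distr M N \<xi>" and \<xi>: "\<xi> \<in> M \<rightarrow>\<^sub>M N"
    and h[measurable]: "h \<in> borel_measurable (S \<Otimes>\<^sub>M N)"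
  shows "(\<integral>\<^sup>+\<omega>. h (Y \<omega>, X n \<omega>) \<partial>M) = (\<integral>\<^sup>+\<omega>. \<integral>\<^sup>+\<omega>'. h (Y \<omega>, \<xi> \<omega>') \<partial>M \<partial>M)"
proof -
  have X[measurable]: "\<And>i. X i \<in> M \<rightarrow>\<^sub>M N"
    using indep by (auto simp: indep_vars_def)
  have [measurable]: "Y \<in> M \<rightarrow>\<^sub>M S"
    by (rule measurable_past_imp[OF X Y])
  note \<xi>[measurable]
  interpret D: prob_space "distr M N \<xi>"
    by (rule prob_space_distr) measurable
  have "(\<integral>\<^sup>+\<omega>. h (Y \<omega>, X n \<omega>) \<partial>M) = (\<integral>\<^sup>+p. h p \<partial>distr M (S \<Otimes>\<^sub>M N) (\<lambda>\<omega>. (Y \<omega>, X n \<omega>)))"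
    by (subst nn_integral_distr) auto
  also have "distr M (S \<Otimes>\<^sub>M N) (\<lambda>\<omega>. (Y \<omega>, X n \<omega>)) = distr M S Y \<Otimes>\<^sub>M distr M N \<xi>"
    using distr_past_fresh_sample[OF indep Y] by (simp add: law)
  also have "(\<integral>\<^sup>+p. h p \<partial>(distr M S Y \<Otimes>\<^sub>M distr M N \<xi>)) = (\<integral>\<^sup>+y. \<integral>\<^sup>+u. h (y, u) \<partial>distr M N \<xi> \<partial>distr M S Y)"
    by (rule D.nn_integral_fst[symmetric]) simp
  also have "\<dots> = (\<integral>\<^sup>+\<omega>. \<integral>\<^sup>+u. h (Y \<omega>, u) \<partial>distr M N \<xi> \<partial>M)"
    by (rule nn_integral_distr) auto
  also have "\<dots> = (\<integral>\<^sup>+\<omega>. \<integral>\<^sup>+\<omega>'. h (Y \<omega>, \<xi> \<omega>') \<partial>M \<partial>M)"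
    using measurable_space[of Y M S] by (intro nn_integral_cong nn_integral_distr) auto
  finally show ?thesis .
qed

text \<open>Freezing the past: a bound on the mean over a fresh sample, uniform in the frozen value,
  is a bound on the conditional expectation.\<close>

lemma (in prob_space)
  fixes h :: "'s \<times> 'b \<Rightarrow> real" and b :: "'s \<Rightarrow> real"
  assumes indep: "indep_vars (\<lambda>_. N) X UNIV" and law: "distr M N (X n) = distr M N \<xi>"
    and \<xi>: "\<xi> \<in> M \<rightarrow>\<^sub>M N" and Y: "Y \<in> past M N X n \<rightarrow>\<^sub>M S"
    and h[measurable]: "h \<in> borel_measurable (S \<Otimes>\<^sub>M N)" and nonneg: "\<And>y u. 0 \<le> h (y, u)"
    and int_h: "\<And>y. integrable M (\<lambda>\<omega>. h (y, \<xi> \<omega>))" and mean_le: "\<And>y. (\<integral>\<omega>. h (y, \<xi> \<omega>) \<partial>M) \<le> b y"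
    and integrable: "integrable M (\<lambda>\<omega>. b (Y \<omega>))"
  shows integrable_fresh_sample: "integrable M (\<lambda>\<omega>. h (Y \<omega>, X n \<omega>))" (is ?int)
    and expectation_fresh_sample_le: "A \<in> sets (past M N X n) \<Longrightarrow>
      (\<integral>\<omega>. indicator A \<omega> * h (Y \<omega>, X n \<omega>) \<partial>M) \<le> (\<integral>\<omega>. indicator A \<omega> * b (Y \<omega>) \<partial>M)"
proof -
  have X[measurable]: "\<And>i. X i \<in> M \<rightarrow>\<^sub>M N"
    using indep by (auto simp: indep_vars_def)
  have [measurable]: "Y \<in> M \<rightarrow>\<^sub>M S"
    by (rule measurable_past_imp[OF X Y])
  have b: "0 \<le> b y" for y
    using mean_le[of y] nonneg[of y] by (intro order_trans[OF integral_nonneg_AE]) auto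
  have bound: "(\<integral>\<^sup>+\<omega>. h (y, \<xi> \<omega>) \<partial>M) \<le> ennreal (b y)" for y
    using nn_integral_eq_integral[OF int_h[of y]] nonneg mean_le[of y] by (simp add: ennreal_leI)
  \<comment> \<open>Extended nonnegative integrals come first: the finite bound they give on the
    whole space is what establishes integrability of the left-hand side.\<close>
  have nn: "(\<integral>\<^sup>+\<omega>. ennreal (indicator A \<omega> * h (Y \<omega>, X n \<omega>)) \<partial>M)
      \<le> ennreal (\<integral>\<omega>. indicator A \<omega> * b (Y \<omega>) \<partial>M)"
    and ib: "integrable M (\<lambda>\<omega>. indicator A \<omega> * b (Y \<omega>))" if A: "A \<in> sets (past M N X n)" for A
  proof -
    have [measurable]: "A \<in> sets M"
      using A subalgebra_past[of X M N n, OF X] by (auto simp: subalgebra_def)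
    show ib: "integrable M (\<lambda>\<omega>. indicator A \<omega> * b (Y \<omega>))"
      using integrable_mult_indicator[OF _ integrable, of A] by simp
    have AY: "(\<lambda>\<omega>. (indicator A \<omega> :: real, Y \<omega>)) \<in> past M N X n \<rightarrow>\<^sub>M borel \<Otimes>\<^sub>M S"
      using A Y by measurable
    have "(\<lambda>p. ennreal (fst (fst p) * h (snd (fst p), snd p))) \<in> borel_measurable ((borel \<Otimes>\<^sub>M S) \<Otimes>\<^sub>M N)"
      by measurable
    from nn_integral_past_fresh_sample[OF indep AY law \<xi> this]
    have "(\<integral>\<^sup>+\<omega>. ennreal (indicator A \<omega> * h (Y \<omega>, X n \<omega>)) \<partial>M)
        = (\<integral>\<^sup>+\<omega>. \<integral>\<^sup>+\<omega>'. ennreal (indicator A \<omega> * h (Y \<omega>, \<xi> \<omega>')) \<partial>M \<partial>M)"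
      by simp
    also have "\<dots> \<le> (\<integral>\<^sup>+\<omega>. ennreal (indicator A \<omega> * b (Y \<omega>)) \<partial>M)"
      by (intro nn_integral_mono) (auto simp: bound split: split_indicator)
    also have "\<dots> = ennreal (\<integral>\<omega>. indicator A \<omega> * b (Y \<omega>) \<partial>M)"
      by (intro nn_integral_eq_integral ib) (simp add: b)
    finally show "(\<integral>\<^sup>+\<omega>. ennreal (indicator A \<omega> * h (Y \<omega>, X n \<omega>)) \<partial>M)
      \<le> ennreal (\<integral>\<omega>. indicator A \<omega> * b (Y \<omega>) \<partial>M)" .
  qed
  have "space M \<in> sets (past M N X n)"
    using sets.top[of "past M N X n"] space_past[of X M N n] X by simp
  from nn[OF this] have "(\<integral>\<^sup>+\<omega>. ennreal (h (Y \<omega>, X n \<omega>)) \<partial>M) < \<infinity>"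
    by (simp add: indicator_def le_less_trans[OF _ ennreal_less_top] cong: nn_integral_cong)
  then show ?int
    by (intro integrableI_nonneg) (auto simp: nonneg)
  show "(\<integral>\<omega>. indicator A \<omega> * h (Y \<omega>, X n \<omega>) \<partial>M) \<le> (\<integral>\<omega>. indicator A \<omega> * b (Y \<omega>) \<partial>M)"
    if A: "A \<in> sets (past M N X n)"
  proof -
    have [measurable]: "A \<in> sets M"
      using A subalgebra_past[of X M N n, OF X] by (auto simp: subalgebra_def)
    have "(\<integral>\<omega>. indicator A \<omega> * h (Y \<omega>, X n \<omega>) \<partial>M)
        = enn2real (\<integral>\<^sup>+\<omega>. ennreal (indicator A \<omega> * h (Y \<omega>, X n \<omega>)) \<partial>M)"
      by (intro integral_eq_nn_integral) (auto simp: nonneg)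
    also have "\<dots> \<le> (\<integral>\<omega>. indicator A \<omega> * b (Y \<omega>) \<partial>M)"
      using nn[OF A] by (intro enn2real_leI integral_nonneg) (auto simp: b)
    finally show ?thesis .
  qed
qed

section \<open>Smooth convex objectives\<close>

text \<open>Convexity of the squared norm for the combination of \<open>p\<close> and
  \<open>- w / (1 - \<beta>)\<close> with weights \<open>\<beta>\<close> and
  \<open>1 - \<beta>\<close>; the defect is an explicit square.\<close>

lemma norm_diff_scaled_le:
  fixes p w :: "'a::real_inner"
  assumes "0 \<le> \<beta>" "\<beta> < 1"
  shows "(norm (\<beta> *\<^sub>R p - w))\<^sup>2 \<le> \<beta> * (norm p)\<^sup>2 + (norm w)\<^sup>2 / (1 - \<beta>)"
proof -
  have "\<beta> * (norm p)\<^sup>2 + (norm w)\<^sup>2 / (1 - \<beta>) - (norm (\<beta> *\<^sub>R p - w))\<^sup>2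
      = \<beta> / (1 - \<beta>) * (norm ((1 - \<beta>) *\<^sub>R p + w))\<^sup>2"
    using assms unfolding power2_norm_eq_inner
    by (simp add: inner_diff_left inner_diff_right inner_add_left inner_add_right inner_commute[of w p]
        field_simps power2_eq_square)
  moreover have "0 \<le> \<beta> / (1 - \<beta>) * (norm ((1 - \<beta>) *\<^sub>R p + w))\<^sup>2"
    using assms by simp
  ultimately show ?thesis by linarith
qed

text \<open>Controls the growth of the weight in \<open>energy\<close> over one step. After
  factoring out the old weight, the base \<open>1 + 1 / m\<close> is at least 1, so raising its
  exponent from \<open>q\<close> to 1 only enlarges it.\<close>

lemma powr_Suc_le:
  assumes "0 \<le> q" "q \<le> 1"
  shows "real (Suc (Suc n)) powr q \<le> real (Suc n) powr q + real (Suc n) powr (q - 1)"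
proof -
  let ?m = "real (Suc n)"
  have "real (Suc (Suc n)) powr q = ?m powr q * (1 + 1 / ?m) powr q"
  proof -
    have "?m * (1 + 1 / ?m) = real (Suc (Suc n))"
      by (simp add: distrib_left)
    then show ?thesis
      by (subst powr_mult[symmetric]) auto
  qed
  also have "\<dots> \<le> ?m powr q * (1 + 1 / ?m)"
    using assms powr_mono[of q 1 "1 + 1 / ?m"] by (intro mult_left_mono) auto
  also have "\<dots> = ?m powr q + ?m powr (q - 1)"
    by (simp add: powr_diff field_simps)
  finally show ?thesis .
qed

text \<open>A discrete Gronwall argument: \<open>v n + 1\<close> grows by a factor of at most
  \<open>1 + a n\<close>, hence at most \<open>exp (a n)\<close>. With the resulting bound inserted
  into the error term, the recursion telescopes and leaves a bound for the partial sums of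
  \<open>r\<close>.\<close>

lemma almost_decreasing_bounded_summable:
  fixes v r a :: "nat \<Rightarrow> real"
  assumes step: "\<And>n. v (Suc n) + r n \<le> v n + a n * (v n + 1)"
    and nonneg: "\<And>n. 0 \<le> v n" "\<And>n. 0 \<le> r n" "\<And>n. 0 \<le> a n"
    and a: "summable a"
  shows "\<exists>K. \<forall>n. v n \<le> K" and "summable r"
proof -
  have growth: "v n + 1 \<le> (v 0 + 1) * exp (\<Sum>k<n. a k)" for n
  proof (induction n)
    case (Suc n)
    have "v (Suc n) + 1 \<le> (v n + 1) * (1 + a n)"
      using step[of n] nonneg(2)[of n] by (simp add: algebra_simps)
    also have "\<dots> \<le> ((v 0 + 1) * exp (\<Sum>k<n. a k)) * exp (a n)"
      using Suc nonneg(1,3) by (intro mult_mono) (auto simp: exp_ge_add_one_self add_nonneg_nonneg)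
    finally show ?case
      by (simp add: exp_add mult.assoc)
  qed simp
  define K where "K = (v 0 + 1) * exp (suminf a)"
  have K: "v n + 1 \<le> K" for n
  proof -
    have "(v 0 + 1) * exp (\<Sum>k<n. a k) \<le> K"
      unfolding K_def using nonneg a by (intro mult_left_mono) (auto intro!: sum_le_suminf add_nonneg_nonneg)
    with growth[of n] show ?thesis by linarith
  qed
  then show "\<exists>K. \<forall>n. v n \<le> K"
    by (intro exI[of _ "K - 1"]) (simp add: le_diff_eq)
  have "0 \<le> K" using K[of 0] nonneg(1)[of 0] by linarith
  have part: "v n + (\<Sum>k<n. r k) \<le> v 0 + K * (\<Sum>k<n. a k)" for n
  proof (induction n)
    case (Suc n)
    have "a n * (v n + 1) \<le> a n * K"
      using K nonneg by (intro mult_left_mono) auto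
    with step[of n] Suc show ?case
      by (simp add: algebra_simps)
  qed simp
  show "summable r"
  proof (rule summableI_nonneg_bounded)
    fix n
    have "K * (\<Sum>k<n. a k) \<le> K * suminf a"
      using \<open>0 \<le> K\<close> nonneg a by (intro mult_left_mono) (auto intro!: sum_le_suminf)
    with part[of n] nonneg(1)[of n] show "(\<Sum>k<n. r k) \<le> v 0 + K * suminf a"
      by linarith
  qed (rule nonneg)
qed

locale smooth_convex =
  fixes f :: "'a::euclidean_space \<Rightarrow> real" and gradf :: "'a \<Rightarrow> 'a" and L :: real
  assumes gradient: "GDERIV f z :> gradf z"
    and convex: "convex_on UNIV f"
    and smooth: "norm (gradf z - gradf w) \<le> L * norm (z - w)"
    and L_pos: "0 < L"
    and minimizer: "\<exists>z. \<forall>w. f z \<le> f w"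
begin

definition gap :: "'a \<Rightarrow> real" where
  "gap z = f z - min_value f"

lemma min_value_le: "min_value f \<le> f z"
proof -
  obtain y where "\<forall>w. f y \<le> f w"
    using minimizer by blast
  then show ?thesis
    unfolding min_value_def by (subst Least_equality[of _ "f y"]) auto
qed

lemma gap_nonneg: "0 \<le> gap z"
  using min_value_le by (simp add: gap_def)

lemma minimizer_exists: "\<exists>y. f y = min_value f"
proof -
  obtain y where "\<forall>w. f y \<le> f w"
    using minimizer by blast
  then show ?thesis
    unfolding min_value_def by (subst Least_equality[of _ "f y"]) auto
qed

lemma continuous_objective: "continuous_on S f"
  using gradient unfolding gderiv_def
  by (meson continuous_at_imp_continuous_on has_derivative_continuous)

lemma DERIV_line:
  "((\<lambda>t. f (z + t *\<^sub>R v)) has_real_derivative inner v (gradf (z + t *\<^sub>R v))) (at t)"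
proof -
  have "((\<lambda>t. z + t *\<^sub>R v) has_derivative (\<lambda>h. h *\<^sub>R v)) (at t)"
    by (auto intro!: derivative_eq_intros)
  moreover have "(f has_derivative (\<lambda>h. inner h (gradf (z + t *\<^sub>R v)))) (at (z + t *\<^sub>R v))"
    using gradient unfolding gderiv_def .
  ultimately have "((\<lambda>t. f (z + t *\<^sub>R v)) has_derivative (\<lambda>h. inner (h *\<^sub>R v) (gradf (z + t *\<^sub>R v)))) (at t)"
    by (rule has_derivative_compose)
  then show ?thesis
    by (simp add: has_field_derivative_def mult_commute_abs)
qed

text \<open>The restriction of \<open>f\<close> to the line through \<open>z\<close> and
  \<open>w\<close> is convex and so lies above its tangent at parameter 0; the claim is read off at
  parameter 1.\<close>

lemma gradient_inequality: "f z + inner (gradf z) (w - z) \<le> f w"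
proof -
  define \<phi> where "\<phi> t = f (z + t *\<^sub>R (w - z))" for t :: real
  have "convex_on UNIV \<phi>"
  proof (rule convex_onI)
    fix t x y :: real assume "0 < t" "t < 1"
    have "z + ((1 - t) *\<^sub>R x + t *\<^sub>R y) *\<^sub>R (w - z)
        = (1 - t) *\<^sub>R (z + x *\<^sub>R (w - z)) + t *\<^sub>R (z + y *\<^sub>R (w - z))"
      by (simp add: algebra_simps)
    then show "\<phi> ((1 - t) *\<^sub>R x + t *\<^sub>R y) \<le> (1 - t) * \<phi> x + t * \<phi> y"
      using convex_onD[OF convex, of t "z + x *\<^sub>R (w - z)" "z + y *\<^sub>R (w - z)"] \<open>0 < t\<close> \<open>t < 1\<close>
      by (simp add: \<phi>_def)
  qed simp
  moreover have "(\<phi> has_real_derivative inner (w - z) (gradf z)) (at 0)"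
    unfolding \<phi>_def using DERIV_line[of z "w - z" 0] by simp
  ultimately have "inner (w - z) (gradf z) * (1 - 0) \<le> \<phi> 1 - \<phi> 0"
    by (intro convex_on_imp_above_tangent[of UNIV]) auto
  then show ?thesis
    by (simp add: \<phi>_def inner_commute)
qed

text \<open>Along the segment, subtracting the linear and the quadratic term from \<open>f\<close>
  leaves a function whose derivative is nonpositive by the Lipschitz condition on the gradient; its
  endpoint values are compared.\<close>

lemma descent: "f w \<le> f z + inner (gradf z) (w - z) + L / 2 * (norm (w - z))\<^sup>2"
proof -
  define v where "v = w - z"
  define \<phi> where "\<phi> t = f (z + t *\<^sub>R v) - t * inner v (gradf z) - L / 2 * t\<^sup>2 * (norm v)\<^sup>2" for t :: real
  have "\<phi> 1 \<le> \<phi> 0"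
  proof (rule DERIV_nonpos_imp_nonincreasing[of 0 1 \<phi>])
    fix t :: real assume t: "0 \<le> t" "t \<le> 1"
    have "(\<phi> has_real_derivative inner v (gradf (z + t *\<^sub>R v)) - inner v (gradf z) - L * t * (norm v)\<^sup>2) (at t)"
      unfolding \<phi>_def by (auto intro!: derivative_eq_intros DERIV_line)
    moreover have "inner v (gradf (z + t *\<^sub>R v)) - inner v (gradf z) \<le> L * t * (norm v)\<^sup>2"
    proof -
      have "inner v (gradf (z + t *\<^sub>R v)) - inner v (gradf z) = inner v (gradf (z + t *\<^sub>R v) - gradf z)"
        by (simp add: inner_diff_right)
      also have "\<dots> \<le> norm v * norm (gradf (z + t *\<^sub>R v) - gradf z)"
        by (rule norm_cauchy_schwarz)
      also have "\<dots> \<le> norm v * (L * norm (t *\<^sub>R v))"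
        using smooth[of "z + t *\<^sub>R v" z] by (intro mult_left_mono) auto
      finally show ?thesis
        using t by (simp add: power2_eq_square mult_ac)
    qed
    ultimately show "\<exists>y. DERIV \<phi> t :> y \<and> y \<le> 0"
      by (intro exI conjI) auto
  qed simp
  then show ?thesis
    by (simp add: \<phi>_def v_def inner_commute)
qed

text \<open>A gradient step of length \<open>1 / L\<close> lowers the objective by the squared
  gradient norm over \<open>2 * L\<close>, yet cannot go below the minimum.\<close>

lemma norm_gradient_le: "(norm (gradf z))\<^sup>2 \<le> 2 * L * gap z"
proof -
  have "min_value f \<le> f (z - (1 / L) *\<^sub>R gradf z)"
    by (rule min_value_le)
  also have "\<dots> \<le> f z - (1 / (2 * L)) * (norm (gradf z))\<^sup>2"
    using descent[of "z - (1 / L) *\<^sub>R gradf z" z] L_pos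
    by (simp add: power2_norm_eq_inner[symmetric] power_mult_distrib power_divide field_simps power2_eq_square)
  finally show ?thesis
    using L_pos by (simp add: gap_def field_simps)
qed

lemma gap_le_dist_minimizer:
  assumes "f y = min_value f"
  shows "gap z \<le> L / 2 * (norm (z - y))\<^sup>2"
proof -
  have "gradf y = 0"
    using norm_gradient_le[of y] assms by (simp add: gap_def)
  then show ?thesis
    using descent[of z y] assms by (simp add: gap_def)
qed

text \<open>Moves the gap between the iterate and the auxiliary point. In \<open>descent\<close> the
  linear term is split by Young's inequality so that its gradient part costs at most one further
  \<open>gap z\<close>.\<close>

lemma gap_le_gap: "gap w \<le> 2 * gap z + L * (norm (w - z))\<^sup>2"
proof -
  have "inner (gradf z) (w - z) \<le> norm (gradf z) * norm (w - z)"
    by (rule norm_cauchy_schwarz)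
  also have "\<dots> \<le> (norm (gradf z))\<^sup>2 / (2 * L) + L / 2 * (norm (w - z))\<^sup>2"
  proof -
    have "0 \<le> (norm (gradf z) - L * norm (w - z))\<^sup>2 / (2 * L)"
      using L_pos by simp
    also have "\<dots> = (norm (gradf z))\<^sup>2 / (2 * L) + L / 2 * (norm (w - z))\<^sup>2 - norm (gradf z) * norm (w - z)"
      using L_pos by (simp add: power2_eq_square field_simps)
    finally show ?thesis by linarith
  qed
  also have "(norm (gradf z))\<^sup>2 / (2 * L) \<le> gap z"
    using norm_gradient_le[of z] L_pos by (simp add: field_simps)
  finally show ?thesis
    using descent[of w z] by (simp add: gap_def)
qed

lemma inner_gradient_minimizer_ge:
  assumes "f y = min_value f"
  shows "gap z \<le> inner (z - y) (gradf z)"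
  using gradient_inequality[of z y] assms
  by (simp add: gap_def inner_diff_left inner_diff_right inner_commute)

text \<open>Writing \<open>gradf w\<close> as \<open>gradf z\<close> plus a difference produces the
  square of \<open>norm (gradf z)\<close>, which pays for the same square left by Young's inequality
  on the cross term. This limits the harm of stepping along a gradient taken at a displaced
  point.\<close>

lemma inner_gradients_ge: "- (L\<^sup>2 * (norm (w - z))\<^sup>2) \<le> inner (gradf w) (gradf z)"
proof -
  have "- inner (gradf w - gradf z) (gradf z) \<le> norm (gradf w - gradf z) * norm (gradf z)"
    using Cauchy_Schwarz_ineq2[of "gradf w - gradf z" "gradf z"] by linarith
  also have "\<dots> \<le> (L * norm (w - z)) * norm (gradf z)"
    by (intro mult_right_mono smooth) simp
  also have "\<dots> \<le> (L * norm (w - z))\<^sup>2 + (norm (gradf z))\<^sup>2"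
  proof -
    have "0 \<le> (L * norm (w - z)) * norm (gradf z)"
      using L_pos by simp
    with sum_squares_bound[of "L * norm (w - z)" "norm (gradf z)"] show ?thesis
      by linarith
  qed
  finally show ?thesis
    by (simp add: inner_diff_left power2_norm_eq_inner power_mult_distrib)
qed

end

section \<open>The momentum recursion\<close>

text \<open>
  The state is a pair \<open>(z, p)\<close> with iterate \<open>z - p\<close>. All three methods become this recursion:
  plain SGD with \<open>\<beta> = c = 0\<close>, SHB with \<open>c = \<beta> / (1 - \<beta>)\<close> and SNAG with \<open>c = \<beta>\<^sup>2 / (1 - \<beta>)\<close>.
  Time is shifted to start at 0, so \<open>S n\<close>, \<open>X n\<close> and \<open>\<alpha> n\<close> belong to time \<open>n + 1\<close>.
\<close>

locale stochastic_momentum = prob_space M + smooth_convex f gradf L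
  for M :: "'w measure" and f :: "'a::euclidean_space \<Rightarrow> real" and gradf :: "'a \<Rightarrow> 'a" and L :: real +
  fixes N :: "'b measure" and G :: "'a \<Rightarrow> 'b \<Rightarrow> 'a" and \<xi> :: "'w \<Rightarrow> 'b" and X :: "nat \<Rightarrow> 'w \<Rightarrow> 'b"
    and \<alpha> :: "nat \<Rightarrow> real" and A B C \<beta> c \<eta>\<^sub>1 \<eta>\<^sub>2 q :: real and S :: "nat \<Rightarrow> 'w \<Rightarrow> 'a \<times> 'a"
  assumes random_element[measurable]: "\<xi> \<in> M \<rightarrow>\<^sub>M N"
    and G_measurable: "(\<lambda>(z, u). G z u) \<in> borel_measurable (borel \<Otimes>\<^sub>M N)"
    and G_integrable: "integrable M (\<lambda>\<omega>. G z (\<xi> \<omega>))"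
    and unbiased: "(\<integral>\<omega>. G z (\<xi> \<omega>) \<partial>M) = gradf z"
    and constants: "0 \<le> A" "0 \<le> B" "0 \<le> C"
    and second_moment_finite: "integrable M (\<lambda>\<omega>. (norm (G z (\<xi> \<omega>)))\<^sup>2)"
    and second_moment:
      "(\<integral>\<omega>. (norm (G z (\<xi> \<omega>)))\<^sup>2 \<partial>M) \<le> A * gap z + B * (norm (gradf z))\<^sup>2 + C"
    and samples_indep: "indep_vars (\<lambda>_. N) X UNIV"
    and samples_law: "distr M N (X n) = distr M N \<xi>"
    and beta: "0 \<le> \<beta>" "\<beta> < 1"
    and rate: "0 < q" "q < 1 / 3"
    and step_size_consts: "0 < \<eta>\<^sub>1" "0 < \<eta>\<^sub>2"
    and step_size_ge: "\<eta>\<^sub>1 * real (Suc n) powr (q - 1) \<le> \<alpha> n"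
    and step_size_le: "\<alpha> n \<le> \<eta>\<^sub>2 * real (Suc n) powr (q - 1)"
    and initial: "\<exists>s. \<forall>\<omega>\<in>space M. S 0 \<omega> = s"
    and recursion: "\<omega> \<in> space M \<Longrightarrow> S (Suc n) \<omega> =
      (fst (S n \<omega>) - (\<alpha> n / (1 - \<beta>)) *\<^sub>R G (fst (S n \<omega>) - snd (S n \<omega>)) (X n \<omega>),
       \<beta> *\<^sub>R snd (S n \<omega>) - (c * \<alpha> n) *\<^sub>R G (fst (S n \<omega>) - snd (S n \<omega>)) (X n \<omega>))"
begin

definition \<kappa> :: real where "\<kappa> = 1 / (1 - \<beta>)"

text \<open>State and sample are separate arguments, so that the mean over the sample can be taken
  with the state frozen.\<close>

definition advance :: "nat \<Rightarrow> 'a \<times> 'a \<Rightarrow> 'b \<Rightarrow> 'a \<times> 'a" where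
  "advance n s u = (fst s - (\<kappa> * \<alpha> n) *\<^sub>R G (fst s - snd s) u, \<beta> *\<^sub>R snd s - (c * \<alpha> n) *\<^sub>R G (fst s - snd s) u)"

text \<open>The coefficient \<open>k = \<kappa>\<^sup>2 + \<kappa>\<close> solves \<open>k \<beta> + \<kappa> = k - 1\<close>: the contraction of \<open>p\<close> absorbs the
  cross term between \<open>p\<close> and the gradient and still leaves \<open>|p|\<^sup>2\<close> for the dissipation.\<close>

definition lyapunov :: "'a \<Rightarrow> 'a \<times> 'a \<Rightarrow> real" where
  "lyapunov y s = (norm (fst s - y))\<^sup>2 + (\<kappa>\<^sup>2 + \<kappa>) * (norm (snd s))\<^sup>2"

definition energy :: "nat \<Rightarrow> 'a \<times> 'a \<Rightarrow> real" where
  "energy n s = real (Suc n) powr q * (gap (fst s) + (norm (snd s))\<^sup>2)"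

definition dissipation :: "nat \<Rightarrow> 'a \<times> 'a \<Rightarrow> real" where
  "dissipation n s = (norm (snd s))\<^sup>2 + \<alpha> n * gap (fst s - snd s)"

text \<open>\<open>K\<^sub>1\<close> absorbs the gradient term of the second moment bound into the
  gap via \<open>norm_gradient_le\<close>. \<open>K\<^sub>2\<close> collects the coefficients of
  order \<open>(\<alpha> n)\<^sup>2\<close> in \<open>lyapunov_mean_le\<close>.
  \<open>K\<^sub>3\<close> multiplies the squared stochastic gradient in
  \<open>energy_advance_le\<close>, and \<open>K\<^sub>4\<close> is the sum of the four coefficients
  that arise in \<open>energy_mean_le\<close>.\<close>

definition K\<^sub>1 where "K\<^sub>1 = A + 2 * L * B"
definition K\<^sub>2 where "K\<^sub>2 = (\<kappa>\<^sup>2 + (\<kappa>\<^sup>2 + \<kappa>) * (\<kappa> * c\<^sup>2)) * (K\<^sub>1 * L + C) + 2 * \<kappa> * L\<^sup>2"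
definition K\<^sub>3 where "K\<^sub>3 = L / 2 * \<kappa>\<^sup>2 + \<kappa> * c\<^sup>2"
definition K\<^sub>4 where "K\<^sub>4 = 2 / \<eta>\<^sub>1 + (L + 1) + 2 * \<kappa> * L\<^sup>2 * \<eta>\<^sub>2 + 2 * K\<^sub>3 * (K\<^sub>1 * L + C)"

lemma \<kappa>_ge_1: "1 \<le> \<kappa>"
  using beta by (simp add: \<kappa>_def field_simps)

lemma const_nonneg: "0 \<le> \<kappa>" "0 \<le> K\<^sub>1" "0 \<le> K\<^sub>2" "0 \<le> K\<^sub>3" "0 \<le> K\<^sub>4" "0 \<le> K\<^sub>1 * L + C"
proof -
  show k: "0 \<le> \<kappa>" using \<kappa>_ge_1 by linarith
  show k1: "0 \<le> K\<^sub>1" unfolding K\<^sub>1_def using constants L_pos by simp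
  show k1': "0 \<le> K\<^sub>1 * L + C" using k1 constants L_pos by simp
  show "0 \<le> K\<^sub>2" unfolding K\<^sub>2_def using k k1' L_pos by simp
  show k3: "0 \<le> K\<^sub>3" unfolding K\<^sub>3_def using k L_pos by simp
  show "0 \<le> K\<^sub>4" unfolding K\<^sub>4_def using k k3 k1' L_pos step_size_consts by simp
qed

section \<open>Step sizes and their summability\<close>

lemma step_size_pos: "0 < \<alpha> n"
  using step_size_ge[of n] step_size_consts by (smt (verit) mult_pos_pos of_nat_0_less_iff powr_gt_zero zero_less_Suc)

lemma powr_le_step_size: "real (Suc n) powr (q - 1) \<le> \<alpha> n / \<eta>\<^sub>1"
  using step_size_ge[of n] step_size_consts by (simp add: field_simps)

lemma powr_mult_step_size_le: "real (Suc n) powr q * \<alpha> n \<le> \<eta>\<^sub>2"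
proof -
  have "real (Suc n) powr q * \<alpha> n \<le> real (Suc n) powr q * (\<eta>\<^sub>2 * real (Suc n) powr (q - 1))"
    by (intro mult_left_mono step_size_le) simp
  also have "\<dots> = \<eta>\<^sub>2 * real (Suc n) powr (2 * q - 1)"
    by (simp add: powr_add[symmetric] algebra_simps)
  also have "\<dots> \<le> \<eta>\<^sub>2 * 1"
    using rate step_size_consts powr_mono[of "2 * q - 1" 0 "real (Suc n)"] by (intro mult_left_mono) auto
  finally show ?thesis by simp
qed

text \<open>The exponents of weight and squared step size add up to \<open>3 * q - 2\<close>, which
  is below -1 because \<open>q < 1 / 3\<close>.\<close>

lemma summable_weighted_step_size: "summable (\<lambda>n. real (Suc n) powr q * (\<alpha> n)\<^sup>2)"
proof (rule summable_comparison_test')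
  have "summable (\<lambda>n. real n powr (3 * q - 2))"
    using rate by (simp add: summable_real_powr_iff)
  then have "summable (\<lambda>n. real (Suc n) powr (3 * q - 2))"
    by (rule summable_Suc_iff[THEN iffD2])
  then show "summable (\<lambda>n. \<eta>\<^sub>2\<^sup>2 * real (Suc n) powr (3 * q - 2))"
    by (rule summable_mult)
  fix n :: nat assume "0 \<le> n"
  have "(\<alpha> n)\<^sup>2 \<le> (\<eta>\<^sub>2 * real (Suc n) powr (q - 1))\<^sup>2"
    using step_size_le[of n] step_size_pos[of n] by (intro power_mono) auto
  then have "real (Suc n) powr q * (\<alpha> n)\<^sup>2 \<le> real (Suc n) powr q * (\<eta>\<^sub>2 * real (Suc n) powr (q - 1))\<^sup>2"
    by (intro mult_left_mono) auto
  also have "\<dots> = \<eta>\<^sub>2\<^sup>2 * real (Suc n) powr (3 * q - 2)"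
    by (simp add: power_mult_distrib power2_eq_square powr_add[symmetric] algebra_simps)
  finally show "norm (real (Suc n) powr q * (\<alpha> n)\<^sup>2) \<le> \<eta>\<^sub>2\<^sup>2 * real (Suc n) powr (3 * q - 2)"
    by simp
qed

lemma summable_step_size_squared: "summable (\<lambda>n. (\<alpha> n)\<^sup>2)"
proof (rule summable_comparison_test'[OF summable_weighted_step_size])
  fix n :: nat
  have "1 \<le> real (Suc n) powr q"
    using rate by (intro ge_one_powr_ge_zero) auto
  then show "norm ((\<alpha> n)\<^sup>2) \<le> real (Suc n) powr q * (\<alpha> n)\<^sup>2"
    using mult_right_mono[of 1 "real (Suc n) powr q" "(\<alpha> n)\<^sup>2"] by simp
qed

text \<open>Smoothness bounds the gap by the squared distance to a minimizer, and the coefficient of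
  the momentum part is at least 1. Noise proportional to the gap thereby becomes a multiple of
  \<open>lyapunov y s\<close>.\<close>

lemma gap_le_lyapunov:
  assumes "f y = min_value f"
  shows "gap (fst s - snd s) \<le> L * lyapunov y s" "gap (fst s) \<le> L * lyapunov y s"
    "(norm (snd s))\<^sup>2 \<le> lyapunov y s"
proof -
  have k: "1 \<le> \<kappa>\<^sup>2 + \<kappa>"
    using \<kappa>_ge_1 zero_le_power2[of \<kappa>] by linarith
  then have p: "(norm (snd s))\<^sup>2 \<le> (\<kappa>\<^sup>2 + \<kappa>) * (norm (snd s))\<^sup>2"
    using mult_right_mono[of 1 "\<kappa>\<^sup>2 + \<kappa>" "(norm (snd s))\<^sup>2"] by simp
  then show "(norm (snd s))\<^sup>2 \<le> lyapunov y s"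
    by (simp add: lyapunov_def add_increasing)
  have z: "(norm (fst s - y))\<^sup>2 \<le> lyapunov y s"
    using k by (simp add: lyapunov_def)
  have "gap (fst s) \<le> L / 2 * (norm (fst s - y))\<^sup>2"
    by (rule gap_le_dist_minimizer[OF assms])
  also have "\<dots> \<le> L * lyapunov y s"
    using z L_pos by (intro mult_mono) auto
  finally show "gap (fst s) \<le> L * lyapunov y s" .
  have "(norm (fst s - snd s - y))\<^sup>2 \<le> (norm (fst s - y) + norm (snd s))\<^sup>2"
    using norm_triangle_ineq4[of "fst s - y" "snd s"] by (intro power_mono) (auto simp: algebra_simps)
  also have "\<dots> \<le> 2 * (norm (fst s - y))\<^sup>2 + 2 * (norm (snd s))\<^sup>2"
    using sum_squares_bound[of "norm (fst s - y)" "norm (snd s)"] by (simp add: power2_sum)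
  also have "\<dots> \<le> 2 * lyapunov y s"
    using p by (simp add: lyapunov_def)
  finally have "L / 2 * (norm (fst s - snd s - y))\<^sup>2 \<le> L / 2 * (2 * lyapunov y s)"
    using L_pos by (intro mult_left_mono) auto
  with gap_le_dist_minimizer[OF assms, of "fst s - snd s"]
  show "gap (fst s - snd s) \<le> L * lyapunov y s"
    by simp
qed

lemma lyapunov_nonneg: "0 \<le> lyapunov y s"
  using const_nonneg by (simp add: lyapunov_def)

lemma energy_nonneg: "0 \<le> energy n s"
  by (simp add: energy_def gap_nonneg)

lemma dissipation_nonneg: "0 \<le> dissipation n s"
  using step_size_pos[of n] by (simp add: dissipation_def gap_nonneg)

section \<open>One-step bounds in the mean\<close>

text \<open>The common pattern for both functionals: a nonnegative quantity below a quadratic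
  polynomial in the stochastic gradient is integrable, the linear term averages by unbiasedness, and
  the quadratic term by the second moment bound.\<close>

lemma
  fixes h :: "'b \<Rightarrow> real"
  assumes h[measurable]: "h \<in> borel_measurable N" and nonneg: "\<And>u. 0 \<le> h u" and "0 \<le> e"
    and le: "\<And>u. h u \<le> a + inner v (G x u) + e * (norm (G x u))\<^sup>2"
  shows integrable_quadratic_bound: "integrable M (\<lambda>\<omega>. h (\<xi> \<omega>))"
    and mean_quadratic_bound: "(\<integral>\<omega>. h (\<xi> \<omega>) \<partial>M) \<le> a + inner v (gradf x) + e * (K\<^sub>1 * gap x + C)"
proof -
  have I: "integrable M (\<lambda>\<omega>. a + inner v (G x (\<xi> \<omega>)) + e * (norm (G x (\<xi> \<omega>)))\<^sup>2)"
    using G_integrable second_moment_finite by (intro Bochner_Integration.integrable_add integrable_inner_right integrable_mult_right) auto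
  show int: "integrable M (\<lambda>\<omega>. h (\<xi> \<omega>))"
    using le nonneg by (intro Bochner_Integration.integrable_bound[OF I]) (auto intro!: AE_I2 order_trans[OF _ abs_ge_self])
  have "(\<integral>\<omega>. h (\<xi> \<omega>) \<partial>M) \<le> (\<integral>\<omega>. a + inner v (G x (\<xi> \<omega>)) + e * (norm (G x (\<xi> \<omega>)))\<^sup>2 \<partial>M)"
    by (intro integral_mono int I le)
  also have "\<dots> = a + inner v (gradf x) + e * (\<integral>\<omega>. (norm (G x (\<xi> \<omega>)))\<^sup>2 \<partial>M)"
    using G_integrable second_moment_finite by (simp add: prob_space unbiased)
  also have "(\<integral>\<omega>. (norm (G x (\<xi> \<omega>)))\<^sup>2 \<partial>M) \<le> K\<^sub>1 * gap x + C"
  proof -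
    have "B * (norm (gradf x))\<^sup>2 \<le> B * (2 * L * gap x)"
      by (intro mult_left_mono norm_gradient_le constants)
    with second_moment[of x] show ?thesis
      by (simp add: K\<^sub>1_def algebra_simps)
  qed
  finally show "(\<integral>\<omega>. h (\<xi> \<omega>) \<partial>M) \<le> a + inner v (gradf x) + e * (K\<^sub>1 * gap x + C)"
    using \<open>0 \<le> e\<close> by (simp add: mult_left_mono)
qed

lemma norm_momentum_le:
  "(norm (snd (advance n s u)))\<^sup>2 \<le> \<beta> * (norm (snd s))\<^sup>2 + \<kappa> * c\<^sup>2 * (\<alpha> n)\<^sup>2 * (norm (G (fst s - snd s) u))\<^sup>2"
  using norm_diff_scaled_le[OF beta, of "snd s" "(c * \<alpha> n) *\<^sub>R G (fst s - snd s) u"]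
  by (simp add: advance_def \<kappa>_def power_mult_distrib)

lemma lyapunov_advance_le:
  "lyapunov y (advance n s u) \<le>
     ((norm (fst s - y))\<^sup>2 + (\<kappa>\<^sup>2 + \<kappa>) * \<beta> * (norm (snd s))\<^sup>2)
     + inner (- (2 * \<kappa> * \<alpha> n) *\<^sub>R (fst s - y)) (G (fst s - snd s) u)
     + ((\<kappa>\<^sup>2 + (\<kappa>\<^sup>2 + \<kappa>) * (\<kappa> * c\<^sup>2)) * (\<alpha> n)\<^sup>2) * (norm (G (fst s - snd s) u))\<^sup>2"
proof -
  let ?g = "G (fst s - snd s) u"
  have "(norm (fst (advance n s u) - y))\<^sup>2 = (norm (fst s - y))\<^sup>2
      + inner (- (2 * \<kappa> * \<alpha> n) *\<^sub>R (fst s - y)) ?g + \<kappa>\<^sup>2 * (\<alpha> n)\<^sup>2 * (norm ?g)\<^sup>2"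
    unfolding advance_def power2_norm_eq_inner
    by (simp add: inner_diff_left inner_diff_right inner_commute power2_eq_square algebra_simps)
  moreover have "(\<kappa>\<^sup>2 + \<kappa>) * (norm (snd (advance n s u)))\<^sup>2
      \<le> (\<kappa>\<^sup>2 + \<kappa>) * (\<beta> * (norm (snd s))\<^sup>2 + \<kappa> * c\<^sup>2 * (\<alpha> n)\<^sup>2 * (norm ?g)\<^sup>2)"
    using const_nonneg(1) by (intro mult_left_mono norm_momentum_le) simp
  ultimately show ?thesis
    by (simp add: lyapunov_def algebra_simps)
qed

text \<open>The gradient is taken at the iterate, whereas the distance is measured from the
  auxiliary point. Splitting \<open>fst s - y\<close> into the iterate minus \<open>y\<close> plus
  the momentum yields the gap by convexity and a cross term that the contraction of the momentum
  pays for.\<close>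

lemma lyapunov_mean_le:
  assumes y: "f y = min_value f"
  shows "((norm (fst s - y))\<^sup>2 + (\<kappa>\<^sup>2 + \<kappa>) * \<beta> * (norm (snd s))\<^sup>2)
     + inner (- (2 * \<kappa> * \<alpha> n) *\<^sub>R (fst s - y)) (gradf (fst s - snd s))
     + ((\<kappa>\<^sup>2 + (\<kappa>\<^sup>2 + \<kappa>) * (\<kappa> * c\<^sup>2)) * (\<alpha> n)\<^sup>2) * (K\<^sub>1 * gap (fst s - snd s) + C)
   \<le> lyapunov y s - dissipation n s + K\<^sub>2 * (\<alpha> n)\<^sup>2 * (lyapunov y s + 1)"
proof -
  let ?x = "fst s - snd s" and ?p = "snd s" and ?a = "\<alpha> n" and ?V = "lyapunov y s"
  let ?k = "\<kappa>\<^sup>2 + (\<kappa>\<^sup>2 + \<kappa>) * (\<kappa> * c\<^sup>2)"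
  have a: "0 < ?a" by (rule step_size_pos)
  have F: "0 \<le> gap ?x" "gap ?x \<le> L * ?V"
    using gap_nonneg gap_le_lyapunov[OF y] by auto
  have V: "0 \<le> ?V" by (rule lyapunov_nonneg)
  have k: "1 \<le> \<kappa>" "0 \<le> ?k"
    using \<kappa>_ge_1 by auto
  have "inner (fst s - y) (gradf ?x) = inner (?x - y) (gradf ?x) + inner ?p (gradf ?x)"
    by (simp add: inner_diff_left)
  moreover have "gap ?x \<le> inner (?x - y) (gradf ?x)"
    by (rule inner_gradient_minimizer_ge[OF y])
  moreover have "- (norm ?p * norm (gradf ?x)) \<le> inner ?p (gradf ?x)"
    using Cauchy_Schwarz_ineq2[of ?p "gradf ?x"] by linarith
  ultimately have "gap ?x - norm ?p * norm (gradf ?x) \<le> inner (fst s - y) (gradf ?x)"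
    by linarith
  then have "(2 * \<kappa> * ?a) * (gap ?x - norm ?p * norm (gradf ?x)) \<le> (2 * \<kappa> * ?a) * inner (fst s - y) (gradf ?x)"
    using a k by (intro mult_left_mono) auto
  \<comment> \<open>Young's inequality with the step size attached to the gradient: the squared
    momentum appears without it, and the gradient part is of second order in the step size.\<close>
  moreover have "(2 * \<kappa> * ?a) * (norm ?p * norm (gradf ?x)) \<le> \<kappa> * (norm ?p)\<^sup>2 + 2 * \<kappa> * L * ?a\<^sup>2 * gap ?x"
  proof -
    have "2 * norm ?p * (?a * norm (gradf ?x)) \<le> (norm ?p)\<^sup>2 + (?a * norm (gradf ?x))\<^sup>2"
      by (rule sum_squares_bound)
    also have "(?a * norm (gradf ?x))\<^sup>2 \<le> ?a\<^sup>2 * (2 * L * gap ?x)"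
      unfolding power_mult_distrib by (intro mult_left_mono norm_gradient_le) simp
    finally have "\<kappa> * (2 * norm ?p * (?a * norm (gradf ?x))) \<le> \<kappa> * ((norm ?p)\<^sup>2 + ?a\<^sup>2 * (2 * L * gap ?x))"
      using k by (intro mult_left_mono) auto
    then show ?thesis
      by (simp add: algebra_simps)
  qed
  \<comment> \<open>Of the available multiple \<open>2 * \<kappa>\<close> of the gap term, one copy
    suffices for the dissipation.\<close>
  moreover have "1 * (?a * gap ?x) \<le> (2 * \<kappa>) * (?a * gap ?x)"
    using a k F by (intro mult_right_mono) auto
  ultimately have cross: "- (2 * \<kappa> * ?a) * inner (fst s - y) (gradf ?x)
      \<le> \<kappa> * (norm ?p)\<^sup>2 + 2 * \<kappa> * L * ?a\<^sup>2 * gap ?x - ?a * gap ?x"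
    by (simp add: algebra_simps)
  \<comment> \<open>All remaining terms carry the squared step size; bounding the gap by
    \<open>L * ?V\<close> brings them under a multiple of \<open>?V + 1\<close>.\<close>
  have "?a\<^sup>2 * (2 * \<kappa> * L * gap ?x) \<le> ?a\<^sup>2 * (2 * \<kappa> * L * (L * (?V + 1)))"
    using F V k L_pos by (intro mult_left_mono) (auto simp: distrib_left)
  moreover have "(?k * ?a\<^sup>2) * (K\<^sub>1 * gap ?x + C) \<le> (?k * ?a\<^sup>2) * ((K\<^sub>1 * L + C) * (?V + 1))"
  proof (intro mult_left_mono)
    have "K\<^sub>1 * gap ?x \<le> K\<^sub>1 * (L * ?V)"
      using const_nonneg F by (intro mult_left_mono) auto
    moreover have "0 \<le> C * ?V" "0 \<le> K\<^sub>1 * L"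
      using constants V const_nonneg L_pos by auto
    ultimately show "K\<^sub>1 * gap ?x + C \<le> (K\<^sub>1 * L + C) * (?V + 1)"
      by (simp add: algebra_simps)
  qed (use k in simp)
  ultimately have noise: "2 * \<kappa> * L * ?a\<^sup>2 * gap ?x + (?k * ?a\<^sup>2) * (K\<^sub>1 * gap ?x + C) \<le> K\<^sub>2 * ?a\<^sup>2 * (?V + 1)"
    by (simp add: K\<^sub>2_def power2_eq_square algebra_simps)
  have "(\<kappa>\<^sup>2 + \<kappa>) * \<beta> + \<kappa> = (\<kappa>\<^sup>2 + \<kappa>) - 1"
  proof -
    have "\<kappa> * \<beta> = \<kappa> - 1"
      using beta by (simp add: \<kappa>_def field_simps)
    then have "(\<kappa>\<^sup>2 + \<kappa>) * \<beta> = \<kappa> * (\<kappa> - 1) + (\<kappa> - 1)"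
      by (simp add: power2_eq_square distrib_right mult.assoc)
    then show ?thesis
      by (simp add: power2_eq_square algebra_simps)
  qed
  then have "(\<kappa>\<^sup>2 + \<kappa>) * \<beta> * (norm ?p)\<^sup>2 + \<kappa> * (norm ?p)\<^sup>2 = ((\<kappa>\<^sup>2 + \<kappa>) - 1) * (norm ?p)\<^sup>2"
    by (metis distrib_right)
  with cross noise show ?thesis
    by (simp add: lyapunov_def dissipation_def left_diff_distrib)
qed

text \<open>\<open>descent\<close> is expanded at the auxiliary point, whose increment is exactly a
  multiple of the stochastic gradient.\<close>

lemma energy_advance_le:
  fixes n s u
  defines "w \<equiv> real (Suc (Suc n)) powr q"
  shows "energy (Suc n) (advance n s u) \<le>
     w * (gap (fst s) + \<beta> * (norm (snd s))\<^sup>2)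
     + inner (- (w * \<kappa> * \<alpha> n) *\<^sub>R gradf (fst s)) (G (fst s - snd s) u)
     + (w * K\<^sub>3 * (\<alpha> n)\<^sup>2) * (norm (G (fst s - snd s) u))\<^sup>2"
proof -
  let ?g = "G (fst s - snd s) u"
  have "gap (fst (advance n s u)) \<le> gap (fst s) - \<kappa> * \<alpha> n * inner (gradf (fst s)) ?g
      + L / 2 * \<kappa>\<^sup>2 * (\<alpha> n)\<^sup>2 * (norm ?g)\<^sup>2"
    using descent[of "fst (advance n s u)" "fst s"]
    by (simp add: gap_def advance_def power_mult_distrib)
  with norm_momentum_le[of n s u]
  have "gap (fst (advance n s u)) + (norm (snd (advance n s u)))\<^sup>2
    \<le> gap (fst s) - \<kappa> * \<alpha> n * inner (gradf (fst s)) ?g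
      + \<beta> * (norm (snd s))\<^sup>2 + K\<^sub>3 * (\<alpha> n)\<^sup>2 * (norm ?g)\<^sup>2"
    by (simp add: K\<^sub>3_def algebra_simps)
  then have "w * (gap (fst (advance n s u)) + (norm (snd (advance n s u)))\<^sup>2)
    \<le> w * (gap (fst s) - \<kappa> * \<alpha> n * inner (gradf (fst s)) ?g
      + \<beta> * (norm (snd s))\<^sup>2 + K\<^sub>3 * (\<alpha> n)\<^sup>2 * (norm ?g)\<^sup>2)"
    by (intro mult_left_mono) (auto simp: w_def)
  then show ?thesis
    by (simp add: energy_def w_def algebra_simps)
qed

text \<open>Two losses are charged to the dissipation: the possibly negative inner product of the
  gradients at the auxiliary point and at the iterate, and the growth of the weight. The noise stays
  summable after weighting.\<close>

lemma energy_mean_le: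
  fixes n s
  defines "w \<equiv> real (Suc (Suc n)) powr q"
  assumes y: "f y = min_value f"
  shows "w * (gap (fst s) + \<beta> * (norm (snd s))\<^sup>2)
     + inner (- (w * \<kappa> * \<alpha> n) *\<^sub>R gradf (fst s)) (gradf (fst s - snd s))
     + (w * K\<^sub>3 * (\<alpha> n)\<^sup>2) * (K\<^sub>1 * gap (fst s - snd s) + C)
   \<le> energy n s + K\<^sub>4 * (dissipation n s + real (Suc n) powr q * (\<alpha> n)\<^sup>2 * (lyapunov y s + 1))"
proof -
  let ?x = "fst s - snd s" and ?P = "(norm (snd s))\<^sup>2" and ?a = "\<alpha> n" and ?V = "lyapunov y s"
  let ?m = "real (Suc n)"
  have a: "0 < ?a" by (rule step_size_pos)
  have F: "0 \<le> gap ?x" "gap ?x \<le> L * ?V" and Z: "0 \<le> gap (fst s)"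
    using gap_nonneg gap_le_lyapunov[OF y] by auto
  have V: "0 \<le> ?V" by (rule lyapunov_nonneg)
  have k: "0 \<le> \<kappa>" "0 \<le> K\<^sub>3" "0 \<le> K\<^sub>1" "0 \<le> K\<^sub>1 * L + C"
    using const_nonneg by auto
  have m1: "?m powr (q - 1) \<le> 1"
    using rate powr_mono[of "q - 1" 0 ?m] by simp
  have w: "0 \<le> w" "w \<le> ?m powr q + ?m powr (q - 1)"
    using powr_Suc_le[of q n] rate by (auto simp: w_def)
  have "?m powr (q - 1) \<le> ?m powr q"
    by (intro powr_mono) auto
  with w have w2: "w \<le> 2 * ?m powr q" by linarith
  have "- (L\<^sup>2 * ?P) \<le> inner (gradf (fst s)) (gradf ?x)"
    using inner_gradients_ge[of "fst s" ?x] by simp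
  then have "(\<kappa> * ?a) * - (L\<^sup>2 * ?P) \<le> (\<kappa> * ?a) * inner (gradf (fst s)) (gradf ?x)"
    using k a by (intro mult_left_mono) auto
  moreover have "\<beta> * ?P \<le> 1 * ?P"
    using beta by (intro mult_right_mono) auto
  moreover have "K\<^sub>1 * gap ?x + C \<le> (K\<^sub>1 * L + C) * (?V + 1)"
  proof -
    have "K\<^sub>1 * gap ?x \<le> K\<^sub>1 * (L * ?V)"
      using k F by (intro mult_left_mono) auto
    moreover have "0 \<le> C * ?V" "0 \<le> K\<^sub>1 * L"
      using constants V k L_pos by auto
    ultimately show ?thesis
      by (simp add: algebra_simps)
  qed
  then have "(K\<^sub>3 * ?a\<^sup>2) * (K\<^sub>1 * gap ?x + C) \<le> (K\<^sub>3 * ?a\<^sup>2) * ((K\<^sub>1 * L + C) * (?V + 1))"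
    using k by (intro mult_left_mono) auto
  ultimately have "gap (fst s) + \<beta> * ?P - \<kappa> * ?a * inner (gradf (fst s)) (gradf ?x) + K\<^sub>3 * ?a\<^sup>2 * (K\<^sub>1 * gap ?x + C)
    \<le> (gap (fst s) + ?P) + (\<kappa> * L\<^sup>2 * ?a * ?P + K\<^sub>3 * (K\<^sub>1 * L + C) * ?a\<^sup>2 * (?V + 1))"
    by (simp add: mult_ac)
  then have "w * (gap (fst s) + \<beta> * ?P - \<kappa> * ?a * inner (gradf (fst s)) (gradf ?x) + K\<^sub>3 * ?a\<^sup>2 * (K\<^sub>1 * gap ?x + C))
    \<le> w * ((gap (fst s) + ?P) + (\<kappa> * L\<^sup>2 * ?a * ?P + K\<^sub>3 * (K\<^sub>1 * L + C) * ?a\<^sup>2 * (?V + 1)))"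
    using w by (intro mult_left_mono) auto
  also have "\<dots> = w * (gap (fst s) + ?P) + w * (\<kappa> * L\<^sup>2 * ?a * ?P + K\<^sub>3 * (K\<^sub>1 * L + C) * ?a\<^sup>2 * (?V + 1))"
    by (rule distrib_left)
  \<comment> \<open>On the main term the sharp bound for the new weight matters, since its excess
    over the old weight is only \<open>?m powr (q - 1)\<close>; on the error terms a factor of 2 is
    affordable.\<close>
  also have "\<dots> \<le> (?m powr q + ?m powr (q - 1)) * (gap (fst s) + ?P)
      + (2 * ?m powr q) * (\<kappa> * L\<^sup>2 * ?a * ?P + K\<^sub>3 * (K\<^sub>1 * L + C) * ?a\<^sup>2 * (?V + 1))"
    using w w2 Z k a V L_pos by (intro add_mono mult_right_mono) (auto intro!: add_nonneg_nonneg mult_nonneg_nonneg)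
  also have "\<dots> = energy n s + ?m powr (q - 1) * (gap (fst s) + ?P) + 2 * \<kappa> * L\<^sup>2 * (?m powr q * ?a) * ?P
      + 2 * K\<^sub>3 * (K\<^sub>1 * L + C) * (?m powr q * ?a\<^sup>2 * (?V + 1))"
    by (simp add: energy_def algebra_simps)
  finally have main: "w * (gap (fst s) + \<beta> * ?P - \<kappa> * ?a * inner (gradf (fst s)) (gradf ?x) + K\<^sub>3 * ?a\<^sup>2 * (K\<^sub>1 * gap ?x + C))
    \<le> energy n s + ?m powr (q - 1) * (gap (fst s) + ?P) + 2 * \<kappa> * L\<^sup>2 * (?m powr q * ?a) * ?P
      + 2 * K\<^sub>3 * (K\<^sub>1 * L + C) * (?m powr q * ?a\<^sup>2 * (?V + 1))" .
  have D: "?P \<le> dissipation n s" "?a * gap ?x \<le> dissipation n s"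
    using a F by (auto simp: dissipation_def)
  \<comment> \<open>The gap is moved to the iterate, where the dissipation controls it. The factor
    \<open>?m powr (q - 1)\<close> is then traded for \<open>?a / \<eta>\<^sub>1\<close> in front of
    the gap and for 1 in front of the momentum.\<close>
  have "?m powr (q - 1) * (gap (fst s) + ?P) \<le> ?m powr (q - 1) * (2 * gap ?x + (L + 1) * ?P)"
    using gap_le_gap[of "fst s" ?x] by (intro mult_left_mono) (auto simp: algebra_simps)
  also have "\<dots> = 2 * (?m powr (q - 1) * gap ?x) + (L + 1) * (?m powr (q - 1) * ?P)"
    by (simp add: algebra_simps)
  also have "\<dots> \<le> 2 * ((?a / \<eta>\<^sub>1) * gap ?x) + (L + 1) * (1 * ?P)"
    using m1 F L_pos powr_le_step_size[of n]
    by (intro add_mono mult_left_mono[of _ _ 2] mult_left_mono[of _ _ "L + 1"] mult_right_mono) auto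
  also have "2 * ((?a / \<eta>\<^sub>1) * gap ?x) = 2 / \<eta>\<^sub>1 * (?a * gap ?x)"
    by simp
  also have "2 / \<eta>\<^sub>1 * (?a * gap ?x) + (L + 1) * (1 * ?P) \<le> 2 / \<eta>\<^sub>1 * dissipation n s + (L + 1) * dissipation n s"
    using D L_pos step_size_consts by (intro add_mono mult_left_mono) auto
  finally have 1: "?m powr (q - 1) * (gap (fst s) + ?P) \<le> 2 / \<eta>\<^sub>1 * dissipation n s + (L + 1) * dissipation n s" .
  have 2: "2 * \<kappa> * L\<^sup>2 * (?m powr q * ?a) * ?P \<le> 2 * \<kappa> * L\<^sup>2 * \<eta>\<^sub>2 * dissipation n s"
    using D k a powr_mult_step_size_le[of n] step_size_consts by (intro mult_mono mult_left_mono) auto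
  define R where "R = ?m powr q * ?a\<^sup>2 * (?V + 1)"
  have R: "0 \<le> R" using V by (simp add: R_def)
  have D0: "0 \<le> dissipation n s" by (rule dissipation_nonneg)
  \<comment> \<open>\<open>K\<^sub>4\<close> multiplies both the dissipation and \<open>R\<close>;
    these are the surplus products in \<open>K\<^sub>4 * (dissipation n s + R)\<close>.\<close>
  have "0 \<le> 2 * K\<^sub>3 * (K\<^sub>1 * L + C) * dissipation n s"
    "0 \<le> (2 / \<eta>\<^sub>1 + (L + 1) + 2 * \<kappa> * L\<^sup>2 * \<eta>\<^sub>2) * R"
    using k D0 R L_pos step_size_consts by auto
  then have "2 / \<eta>\<^sub>1 * dissipation n s + (L + 1) * dissipation n s + 2 * \<kappa> * L\<^sup>2 * \<eta>\<^sub>2 * dissipation n s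
      + 2 * K\<^sub>3 * (K\<^sub>1 * L + C) * R \<le> K\<^sub>4 * (dissipation n s + R)"
    unfolding K\<^sub>4_def by (simp add: algebra_simps)
  with main 1 2 have "w * (gap (fst s) + \<beta> * ?P - \<kappa> * ?a * inner (gradf (fst s)) (gradf ?x) + K\<^sub>3 * ?a\<^sup>2 * (K\<^sub>1 * gap ?x + C))
    \<le> energy n s + K\<^sub>4 * (dissipation n s + R)"
    unfolding R_def by linarith
  then show ?thesis
    by (simp add: R_def algebra_simps)
qed

section \<open>Measurability of the state and transition along the trajectory\<close>

lemma samples_measurable: "X n \<in> M \<rightarrow>\<^sub>M N"
  using samples_indep by (auto simp: indep_vars_def)

lemma measurable_G:
  assumes "g \<in> borel_measurable P" "h \<in> P \<rightarrow>\<^sub>M N"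
  shows "(\<lambda>w. G (g w) (h w)) \<in> borel_measurable P"
  using measurable_compose[OF measurable_Pair[OF assms] G_measurable] by simp

lemma measurable_fst_snd_state[measurable]:
  "fst \<in> borel \<rightarrow>\<^sub>M (borel :: 'a measure)" "snd \<in> borel \<rightarrow>\<^sub>M (borel :: 'a measure)"
  by (auto intro!: borel_measurable_continuous_onI continuous_intros)

lemma measurable_advance:
  assumes g: "g \<in> P \<rightarrow>\<^sub>M borel" and h: "h \<in> P \<rightarrow>\<^sub>M N"
  shows "(\<lambda>w. advance n (g w) (h w)) \<in> P \<rightarrow>\<^sub>M borel"
proof -
  note g[measurable]
  have [measurable]: "(\<lambda>w. G (fst (g w) - snd (g w)) (h w)) \<in> borel_measurable P"
    by (intro measurable_G h) measurable
  show ?thesis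
    unfolding advance_def by (intro borel_measurable_Pair) measurable
qed

lemma measurable_objective[measurable]: "gap \<in> borel_measurable borel"
  unfolding gap_def
  by (intro borel_measurable_continuous_onI continuous_intros continuous_objective)

lemma measurable_functionals[measurable]:
  "lyapunov y \<in> borel_measurable borel" "energy n \<in> borel_measurable borel"
  "dissipation n \<in> borel_measurable borel"
  unfolding lyapunov_def energy_def dissipation_def by measurable

lemma state_Suc: "\<omega> \<in> space M \<Longrightarrow> S (Suc n) \<omega> = advance n (S n \<omega>) (X n \<omega>)"
  using recursion[of \<omega> n] by (simp add: advance_def \<kappa>_def)

text \<open>Passing to \<open>S (Suc n)\<close> consumes the sample \<open>X n\<close>, so
  \<open>S n\<close> involves only \<open>X 0\<close>, ..., \<open>X (n - 1)\<close> and
  \<open>X n\<close> is still fresh at that moment.\<close>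

lemma adapted: "S n \<in> past M N X n \<rightarrow>\<^sub>M borel"
proof (induction n)
  case 0
  obtain s where "\<forall>\<omega>\<in>space M. S 0 \<omega> = s"
    using initial by blast
  then show ?case
    by (subst measurable_cong[of _ _ "\<lambda>_. s"]) (auto simp: space_past[OF samples_measurable])
next
  case (Suc n)
  have "(\<lambda>\<omega>. advance n (S n \<omega>) (X n \<omega>)) \<in> past M N X (Suc n) \<rightarrow>\<^sub>M borel"
    by (intro measurable_advance measurable_past_Suc[OF samples_measurable Suc]
        measurable_past[OF samples_measurable]) simp
  then show ?case
    by (subst measurable_cong) (auto simp: space_past[OF samples_measurable] state_Suc)
qed

lemma state_measurable[measurable]: "S n \<in> M \<rightarrow>\<^sub>M borel"
  by (rule measurable_past_imp[OF samples_measurable adapted])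

lemma
  fixes \<Phi> b :: "'a \<times> 'a \<Rightarrow> real"
  assumes \<Phi>[measurable]: "\<Phi> \<in> borel_measurable borel" and nonneg: "\<And>s. 0 \<le> \<Phi> s"
    and int: "\<And>s. integrable M (\<lambda>\<omega>. \<Phi> (advance n s (\<xi> \<omega>)))"
    and mean: "\<And>s. (\<integral>\<omega>. \<Phi> (advance n s (\<xi> \<omega>)) \<partial>M) \<le> b s"
    and b: "integrable M (\<lambda>\<omega>. b (S n \<omega>))"
  shows integrable_transition: "integrable M (\<lambda>\<omega>. \<Phi> (S (Suc n) \<omega>))"
    and expectation_transition_le: "E \<in> sets (past M N X n) \<Longrightarrow>
      (\<integral>\<omega>. indicator E \<omega> * \<Phi> (S (Suc n) \<omega>) \<partial>M) \<le> (\<integral>\<omega>. indicator E \<omega> * b (S n \<omega>) \<partial>M)"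
proof -
  have h: "(\<lambda>p. \<Phi> (advance n (fst p) (snd p))) \<in> borel_measurable (borel \<Otimes>\<^sub>M N)"
    by (rule measurable_compose[OF measurable_advance \<Phi>]) auto
  note fresh = samples_indep samples_law[of n] random_element adapted[of n] h
  have "integrable M (\<lambda>\<omega>. \<Phi> (advance n (S n \<omega>) (X n \<omega>)))"
    using integrable_fresh_sample[OF fresh, of b] nonneg int mean b by simp
  then show "integrable M (\<lambda>\<omega>. \<Phi> (S (Suc n) \<omega>))"
    by (subst Bochner_Integration.integrable_cong) (auto simp: state_Suc)
  assume E: "E \<in> sets (past M N X n)"
  have "(\<integral>\<omega>. indicator E \<omega> * \<Phi> (S (Suc n) \<omega>) \<partial>M) = (\<integral>\<omega>. indicator E \<omega> * \<Phi> (advance n (S n \<omega>) (X n \<omega>)) \<partial>M)"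
    by (rule Bochner_Integration.integral_cong) (auto simp: state_Suc)
  also have "\<dots> \<le> (\<integral>\<omega>. indicator E \<omega> * b (S n \<omega>) \<partial>M)"
    using expectation_fresh_sample_le[OF fresh, of b E] nonneg int mean b E by simp
  finally show "(\<integral>\<omega>. indicator E \<omega> * \<Phi> (S (Suc n) \<omega>) \<partial>M) \<le> (\<integral>\<omega>. indicator E \<omega> * b (S n \<omega>) \<partial>M)" .
qed

lemma functional_convergent:
  fixes \<Phi> r :: "nat \<Rightarrow> 'a \<times> 'a \<Rightarrow> real"
  assumes \<Phi>: "\<And>n. \<Phi> n \<in> borel_measurable borel" "\<And>n s. 0 \<le> \<Phi> n s"
    and int: "\<And>n s. integrable M (\<lambda>\<omega>. \<Phi> (Suc n) (advance n s (\<xi> \<omega>)))"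
    and mean: "\<And>n s. (\<integral>\<omega>. \<Phi> (Suc n) (advance n s (\<xi> \<omega>)) \<partial>M) \<le> \<Phi> n s + r n s"
    and r: "\<And>n s. 0 \<le> r n s"
    and integrable: "\<And>n. integrable M (\<lambda>\<omega>. \<Phi> n (S n \<omega>))" "\<And>n. integrable M (\<lambda>\<omega>. r n (S n \<omega>))"
    and w: "\<And>n. (\<integral>\<omega>. r n (S n \<omega>) \<partial>M) \<le> w n" "summable w"
  shows "AE \<omega> in M. convergent (\<lambda>n. \<Phi> n (S n \<omega>))"
proof (rule almost_supermartingale_convergent[where F = "past M N X" and w = w])
  fix n
  show "subalgebra M (past M N X n)" "sets (past M N X n) \<subseteq> sets (past M N X (Suc n))"
    by (rule subalgebra_past[OF samples_measurable] past_mono[OF samples_measurable])+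
  show "(\<lambda>\<omega>. \<Phi> n (S n \<omega>)) \<in> borel_measurable (past M N X n)"
    by (rule measurable_compose[OF adapted \<Phi>(1)])
  fix E assume E: "E \<in> sets (past M N X n)"
  then have EM: "E \<in> sets M"
    using subalgebra_past[of X M N n, OF samples_measurable] by (auto simp: subalgebra_def)
  have b: "integrable M (\<lambda>\<omega>. \<Phi> n (S n \<omega>) + r n (S n \<omega>))"
    using integrable by auto
  have E\<Phi>: "integrable M (\<lambda>\<omega>. indicator E \<omega> * \<Phi> n (S n \<omega>))"
    using integrable_mult_indicator[OF EM integrable(1)] by simp
  have "(\<integral>\<omega>. indicator E \<omega> * \<Phi> (Suc n) (S (Suc n) \<omega>) \<partial>M)
      \<le> (\<integral>\<omega>. indicator E \<omega> * (\<Phi> n (S n \<omega>) + r n (S n \<omega>)) \<partial>M)"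
    by (rule expectation_transition_le[OF \<Phi> int mean b E])
  \<comment> \<open>Since the error \<open>r\<close> is nonnegative, its integral over
    \<open>E\<close> is at most its full mean; this turns a random error into the deterministic
    \<open>w n\<close>.\<close>
  also have "\<dots> \<le> (\<integral>\<omega>. indicator E \<omega> * \<Phi> n (S n \<omega>) + r n (S n \<omega>) \<partial>M)"
  proof (rule integral_mono)
    show "integrable M (\<lambda>\<omega>. indicator E \<omega> * (\<Phi> n (S n \<omega>) + r n (S n \<omega>)))"
      using integrable_mult_indicator[OF EM b] by simp
    show "integrable M (\<lambda>\<omega>. indicator E \<omega> * \<Phi> n (S n \<omega>) + r n (S n \<omega>))"
      using E\<Phi> integrable by auto
    show "indicator E \<omega> * (\<Phi> n (S n \<omega>) + r n (S n \<omega>)) \<le> indicator E \<omega> * \<Phi> n (S n \<omega>) + r n (S n \<omega>)" for \<omega>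
      using r[of n "S n \<omega>"] by (auto simp: indicator_def)
  qed
  also have "\<dots> = (\<integral>\<omega>. indicator E \<omega> * \<Phi> n (S n \<omega>) \<partial>M) + (\<integral>\<omega>. r n (S n \<omega>) \<partial>M)"
    using E\<Phi> integrable by simp
  also have "\<dots> \<le> (\<integral>\<omega>. indicator E \<omega> * \<Phi> n (S n \<omega>) \<partial>M) + w n"
    using w by simp
  finally show "(\<integral>\<omega>. indicator E \<omega> * \<Phi> (Suc n) (S (Suc n) \<omega>) \<partial>M)
      \<le> (\<integral>\<omega>. indicator E \<omega> * \<Phi> n (S n \<omega>) \<partial>M) + w n" .
qed (use \<Phi> integrable w in auto)

lemma
  assumes y: "f y = min_value f"
  shows lyapunov_advance_integrable: "integrable M (\<lambda>\<omega>. lyapunov y (advance n s (\<xi> \<omega>)))"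
    and lyapunov_advance_mean_le: "(\<integral>\<omega>. lyapunov y (advance n s (\<xi> \<omega>)) \<partial>M)
      \<le> lyapunov y s - dissipation n s + K\<^sub>2 * (\<alpha> n)\<^sup>2 * (lyapunov y s + 1)"
proof -
  have m: "(\<lambda>u. lyapunov y (advance n s u)) \<in> borel_measurable N"
    by (rule measurable_compose[OF measurable_advance]) auto
  have e: "0 \<le> (\<kappa>\<^sup>2 + (\<kappa>\<^sup>2 + \<kappa>) * (\<kappa> * c\<^sup>2)) * (\<alpha> n)\<^sup>2"
    using const_nonneg by simp
  note quadratic = m lyapunov_nonneg e lyapunov_advance_le
  show "integrable M (\<lambda>\<omega>. lyapunov y (advance n s (\<xi> \<omega>)))"
    by (rule integrable_quadratic_bound[OF quadratic])
  show "(\<integral>\<omega>. lyapunov y (advance n s (\<xi> \<omega>)) \<partial>M)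
      \<le> lyapunov y s - dissipation n s + K\<^sub>2 * (\<alpha> n)\<^sup>2 * (lyapunov y s + 1)"
    by (rule order_trans[OF mean_quadratic_bound[OF quadratic] lyapunov_mean_le[OF y]])
qed

lemma
  assumes y: "f y = min_value f"
  shows energy_advance_integrable: "integrable M (\<lambda>\<omega>. energy (Suc n) (advance n s (\<xi> \<omega>)))"
    and energy_advance_mean_le: "(\<integral>\<omega>. energy (Suc n) (advance n s (\<xi> \<omega>)) \<partial>M)
      \<le> energy n s + K\<^sub>4 * (dissipation n s + real (Suc n) powr q * (\<alpha> n)\<^sup>2 * (lyapunov y s + 1))"
proof -
  have m: "(\<lambda>u. energy (Suc n) (advance n s u)) \<in> borel_measurable N"
    by (rule measurable_compose[OF measurable_advance]) auto
  have e: "0 \<le> real (Suc (Suc n)) powr q * K\<^sub>3 * (\<alpha> n)\<^sup>2"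
    using const_nonneg by simp
  note quadratic = m energy_nonneg e energy_advance_le
  show "integrable M (\<lambda>\<omega>. energy (Suc n) (advance n s (\<xi> \<omega>)))"
    by (rule integrable_quadratic_bound[OF quadratic])
  show "(\<integral>\<omega>. energy (Suc n) (advance n s (\<xi> \<omega>)) \<partial>M)
      \<le> energy n s + K\<^sub>4 * (dissipation n s + real (Suc n) powr q * (\<alpha> n)\<^sup>2 * (lyapunov y s + 1))"
    by (rule order_trans[OF mean_quadratic_bound[OF quadratic] energy_mean_le[OF y]])
qed

lemma integrable_initial: "\<Phi> \<in> borel_measurable borel \<Longrightarrow> integrable M (\<lambda>\<omega>. \<Phi> (S 0 \<omega>) :: real)"
proof -
  obtain s where "\<forall>\<omega>\<in>space M. S 0 \<omega> = s"
    using initial by blast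
  then show ?thesis
    by (subst Bochner_Integration.integrable_cong[of _ _ _ "\<lambda>_. \<Phi> s"]) auto
qed

section \<open>Integrability, summable dissipation and almost sure limits\<close>

context
  fixes y assumes y: "f y = min_value f"
begin

text \<open>Conditional on integrability at the same time, because the induction step of
  \<open>integrable_lyapunov\<close> relies on it.\<close>

lemma integrable_dissipation_if:
  assumes "integrable M (\<lambda>\<omega>. lyapunov y (S n \<omega>))"
  shows "integrable M (\<lambda>\<omega>. dissipation n (S n \<omega>))"
proof (rule Bochner_Integration.integrable_bound)
  show "integrable M (\<lambda>\<omega>. (1 + \<alpha> n * L) * lyapunov y (S n \<omega>))"
    using assms by simp
  have "dissipation n s \<le> (1 + \<alpha> n * L) * lyapunov y s" for s
    using mult_left_mono[OF gap_le_lyapunov(1)[OF y, of s] less_imp_le[OF step_size_pos[of n]]]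
      gap_le_lyapunov(3)[OF y, of s]
    by (simp add: dissipation_def algebra_simps)
  then have "norm (dissipation n s) \<le> norm ((1 + \<alpha> n * L) * lyapunov y s)" for s
    using dissipation_nonneg[of n s] abs_ge_self[of "(1 + \<alpha> n * L) * lyapunov y s"]
    by (metis abs_of_nonneg order_trans real_norm_def)
  then show "AE \<omega> in M. norm (dissipation n (S n \<omega>)) \<le> norm ((1 + \<alpha> n * L) * lyapunov y (S n \<omega>))"
    by (intro AE_I2)
qed measurable

lemma integrable_lyapunov: "integrable M (\<lambda>\<omega>. lyapunov y (S n \<omega>))"
proof (induction n)
  case (Suc n)
  show ?case
    by (rule integrable_transition[OF _ lyapunov_nonneg lyapunov_advance_integrable[OF y] lyapunov_advance_mean_le[OF y]])
      (use Suc integrable_dissipation_if[OF Suc] in auto)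
qed (rule integrable_initial, simp)

lemmas integrable_dissipation = integrable_dissipation_if[OF integrable_lyapunov]

lemma integrable_energy: "integrable M (\<lambda>\<omega>. energy n (S n \<omega>))"
proof (induction n)
  case (Suc n)
  show ?case
    by (rule integrable_transition[OF _ energy_nonneg energy_advance_integrable[OF y] energy_advance_mean_le[OF y]])
      (use Suc integrable_dissipation integrable_lyapunov in auto)
qed (rule integrable_initial, simp)

text \<open>The one-step bound is integrated over the whole space, which gives a deterministic
  recursion for the means with summable coefficients
  \<open>K\<^sub>2 * (\<alpha> n)\<^sup>2\<close>.\<close>

lemma lyapunov_bounded: "\<exists>K. \<forall>n. (\<integral>\<omega>. lyapunov y (S n \<omega>) \<partial>M) \<le> K"
  and summable_dissipation: "summable (\<lambda>n. \<integral>\<omega>. dissipation n (S n \<omega>) \<partial>M)"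
proof -
  have "(\<integral>\<omega>. lyapunov y (S (Suc n) \<omega>) \<partial>M) + (\<integral>\<omega>. dissipation n (S n \<omega>) \<partial>M)
    \<le> (\<integral>\<omega>. lyapunov y (S n \<omega>) \<partial>M) + K\<^sub>2 * (\<alpha> n)\<^sup>2 * ((\<integral>\<omega>. lyapunov y (S n \<omega>) \<partial>M) + 1)" for n
  proof -
    let ?b = "\<lambda>s. lyapunov y s - dissipation n s + K\<^sub>2 * (\<alpha> n)\<^sup>2 * (lyapunov y s + 1)"
    have b: "integrable M (\<lambda>\<omega>. ?b (S n \<omega>))"
      using integrable_lyapunov integrable_dissipation by auto
    have "space M \<in> sets (past M N X n)"
      using sets.top[of "past M N X n"] by (simp add: space_past[OF samples_measurable])
    from expectation_transition_le[OF _ lyapunov_nonneg lyapunov_advance_integrable[OF y] lyapunov_advance_mean_le[OF y] b this]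
    have "(\<integral>\<omega>. lyapunov y (S (Suc n) \<omega>) \<partial>M) \<le> (\<integral>\<omega>. ?b (S n \<omega>) \<partial>M)"
      by (simp cong: Bochner_Integration.integral_cong)
    also have "\<dots> = (\<integral>\<omega>. lyapunov y (S n \<omega>) \<partial>M) - (\<integral>\<omega>. dissipation n (S n \<omega>) \<partial>M)
        + K\<^sub>2 * (\<alpha> n)\<^sup>2 * ((\<integral>\<omega>. lyapunov y (S n \<omega>) \<partial>M) + 1)"
      using integrable_lyapunov[of n] integrable_dissipation[of n] by (simp add: prob_space)
    finally show ?thesis by simp
  qed
  note decrease = almost_decreasing_bounded_summable[of "\<lambda>n. \<integral>\<omega>. lyapunov y (S n \<omega>) \<partial>M"
      "\<lambda>n. \<integral>\<omega>. dissipation n (S n \<omega>) \<partial>M" "\<lambda>n. K\<^sub>2 * (\<alpha> n)\<^sup>2", OF this]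
  show "\<exists>K. \<forall>n. (\<integral>\<omega>. lyapunov y (S n \<omega>) \<partial>M) \<le> K"
    and "summable (\<lambda>n. \<integral>\<omega>. dissipation n (S n \<omega>) \<partial>M)"
    using decrease const_nonneg summable_step_size_squared
    by (auto intro!: integral_nonneg_AE simp: lyapunov_nonneg dissipation_nonneg summable_mult)
qed

text \<open>The dissipation is dropped; boundedness of the means makes the remaining error a
  constant multiple of the summable squared step sizes.\<close>

lemma lyapunov_convergent: "AE \<omega> in M. convergent (\<lambda>n. lyapunov y (S n \<omega>))"
proof -
  obtain K where K: "\<And>n. (\<integral>\<omega>. lyapunov y (S n \<omega>) \<partial>M) \<le> K"
    using lyapunov_bounded by blast
  let ?r = "\<lambda>n s. K\<^sub>2 * (\<alpha> n)\<^sup>2 * (lyapunov y s + 1)"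
  show ?thesis
  proof (rule functional_convergent)
    fix n s
    show "(\<integral>\<omega>. lyapunov y (advance n s (\<xi> \<omega>)) \<partial>M) \<le> lyapunov y s + ?r n s"
      using lyapunov_advance_mean_le[OF y, of n s] dissipation_nonneg[of n s] by linarith
    show "0 \<le> ?r n s"
      using const_nonneg lyapunov_nonneg[of y s] by simp
    show "integrable M (\<lambda>\<omega>. ?r n (S n \<omega>))"
      using integrable_lyapunov by simp
    have "(\<integral>\<omega>. ?r n (S n \<omega>) \<partial>M) = K\<^sub>2 * (\<alpha> n)\<^sup>2 * ((\<integral>\<omega>. lyapunov y (S n \<omega>) \<partial>M) + 1)"
      using integrable_lyapunov[of n] by (simp add: prob_space)
    also have "\<dots> \<le> K\<^sub>2 * (\<alpha> n)\<^sup>2 * (K + 1)"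
      using K[of n] const_nonneg by (intro mult_left_mono) auto
    finally show "(\<integral>\<omega>. ?r n (S n \<omega>) \<partial>M) \<le> K\<^sub>2 * (\<alpha> n)\<^sup>2 * (K + 1)" .
    show "summable (\<lambda>n. K\<^sub>2 * (\<alpha> n)\<^sup>2 * (K + 1))"
      by (intro summable_mult summable_mult2 summable_step_size_squared)
  qed (auto simp: lyapunov_nonneg integrable_lyapunov lyapunov_advance_integrable[OF y])
qed

text \<open>Here the dissipation is part of the error, and its mean is summable by
  \<open>summable_dissipation\<close>.\<close>

lemma energy_convergent: "AE \<omega> in M. convergent (\<lambda>n. energy n (S n \<omega>))"
proof -
  obtain K where K: "\<And>n. (\<integral>\<omega>. lyapunov y (S n \<omega>) \<partial>M) \<le> K"
    using lyapunov_bounded by blast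
  let ?r = "\<lambda>n s. K\<^sub>4 * (dissipation n s + real (Suc n) powr q * (\<alpha> n)\<^sup>2 * (lyapunov y s + 1))"
  let ?w = "\<lambda>n. K\<^sub>4 * ((\<integral>\<omega>. dissipation n (S n \<omega>) \<partial>M) + real (Suc n) powr q * (\<alpha> n)\<^sup>2 * (K + 1))"
  show ?thesis
  proof (rule functional_convergent)
    fix n s
    show "(\<integral>\<omega>. energy (Suc n) (advance n s (\<xi> \<omega>)) \<partial>M) \<le> energy n s + ?r n s"
      by (rule energy_advance_mean_le[OF y])
    show "0 \<le> ?r n s"
      using const_nonneg lyapunov_nonneg[of y s] dissipation_nonneg[of n s] by simp
    show "integrable M (\<lambda>\<omega>. ?r n (S n \<omega>))"
      using integrable_lyapunov integrable_dissipation by simp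
    have "(\<integral>\<omega>. ?r n (S n \<omega>) \<partial>M) = K\<^sub>4 * ((\<integral>\<omega>. dissipation n (S n \<omega>) \<partial>M)
        + real (Suc n) powr q * (\<alpha> n)\<^sup>2 * ((\<integral>\<omega>. lyapunov y (S n \<omega>) \<partial>M) + 1))"
      using integrable_lyapunov[of n] integrable_dissipation[of n] by (simp add: prob_space)
    also have "\<dots> \<le> ?w n"
      using K[of n] const_nonneg by (intro add_left_mono mult_left_mono) auto
    finally show "(\<integral>\<omega>. ?r n (S n \<omega>) \<partial>M) \<le> ?w n" .
    show "summable ?w"
      by (intro summable_mult summable_mult2 summable_add summable_dissipation summable_weighted_step_size)
  qed (auto simp: energy_nonneg integrable_energy energy_advance_integrable[OF y])
qed

end

end

section \<open>Convergence of the iterates\<close>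

text \<open>The sequence is bounded and so has a cluster point \<open>l\<close> in \<open>F\<close>.
  A point of \<open>D\<close> near \<open>l\<close> has a convergent distance to the sequence, which
  must be its small distance to \<open>l\<close>; the triangle inequality then traps the whole tail.
  Working with a dense \<open>D\<close> permits a countable choice later.\<close>

lemma Opial_convergence:
  fixes u :: "nat \<Rightarrow> 'a::euclidean_space"
  assumes D: "D \<noteq> {}" "D \<subseteq> F" "F \<subseteq> closure D"
    and conv: "\<And>y. y \<in> D \<Longrightarrow> convergent (\<lambda>n. norm (u n - y))"
    and limit_points: "\<And>r l. strict_mono r \<Longrightarrow> (u \<circ> r) \<longlonglongrightarrow> l \<Longrightarrow> l \<in> F"
  shows "\<exists>l\<in>F. u \<longlonglongrightarrow> l"
proof -
  obtain y where y: "y \<in> D"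
    using D by blast
  obtain K where K: "\<And>n. norm (u n - y) \<le> K"
    using convergent_imp_Bseq[OF conv[OF y]] unfolding Bseq_def by auto
  have "norm (u n) \<le> K + norm y" for n
    using K[of n] norm_triangle_sub[of "u n" y] by linarith
  then have "bounded (range u)"
    unfolding bounded_iff by blast
  then obtain l r where r: "strict_mono r" and lr: "(u \<circ> r) \<longlonglongrightarrow> l"
    using bounded_imp_convergent_subsequence by blast
  have l: "l \<in> F"
    by (rule limit_points[OF r lr])
  have "u \<longlonglongrightarrow> l"
  proof (rule metric_LIMSEQ_I)
    fix e :: real assume e: "0 < e"
    from l D(3) have "l \<in> closure D" by blast
    then obtain w where w: "w \<in> D" "dist w l < e / 2"
      using e by (auto simp: closure_approachable dest!: spec[of _ "e / 2"])
    obtain d where d: "(\<lambda>n. norm (u n - w)) \<longlonglongrightarrow> d"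
      using conv[OF w(1)] by (auto simp: convergent_def)
    \<comment> \<open>The subsequence identifies the limit of the distances to
      \<open>w\<close>.\<close>
    have "(\<lambda>n. norm ((u \<circ> r) n - w)) \<longlonglongrightarrow> norm (l - w)"
      by (intro tendsto_intros lr)
    moreover have "(\<lambda>n. norm ((u \<circ> r) n - w)) \<longlonglongrightarrow> d"
      using LIMSEQ_subseq_LIMSEQ[OF d r] by (simp add: comp_def)
    ultimately have "d = norm (l - w)"
      by (rule LIMSEQ_unique[symmetric])
    then have "d < e / 2"
      using w by (simp add: dist_norm norm_minus_commute)
    with d have "\<forall>\<^sub>F n in sequentially. norm (u n - w) < e / 2"
      by (rule order_tendstoD)
    then obtain m where m: "\<And>n. m \<le> n \<Longrightarrow> norm (u n - w) < e / 2"
      by (auto simp: eventually_sequentially)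
    have "dist (u n) l < e" if "m \<le> n" for n
      using m[OF that] w(2) dist_triangle[of "u n" l w] by (simp add: dist_norm)
    then show "\<exists>m. \<forall>n\<ge>m. dist (u n) l < e" by blast
  qed
  with l show ?thesis by blast
qed

section \<open>Rate and limit on a single path\<close>

context stochastic_momentum
begin

text \<open>The energy sees the gap at the auxiliary point; \<open>gap_le_gap\<close> transfers it
  to the iterate at the price of the squared momentum, which the energy contains as well.\<close>

lemma path_rate:
  assumes "convergent (\<lambda>n. energy n (S n \<omega>))"
  obtains K where "\<And>n. real (Suc n) powr q * gap (fst (S n \<omega>) - snd (S n \<omega>)) \<le> K"
    and "\<And>n. real (Suc n) powr q * (norm (snd (S n \<omega>)))\<^sup>2 \<le> K"
proof -
  obtain E where E: "\<And>n. energy n (S n \<omega>) \<le> E"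
    using convergent_imp_Bseq[OF assms] unfolding Bseq_def by (auto dest: abs_le_D1)
  have "real (Suc n) powr q * gap (fst s - snd s) \<le> (2 + L) * energy n s" for n s
  proof -
    have "gap (fst s - snd s) \<le> 2 * gap (fst s) + L * (norm (snd s))\<^sup>2"
      using gap_le_gap[of "fst s - snd s" "fst s"] by simp
    also have "\<dots> \<le> (2 + L) * (gap (fst s) + (norm (snd s))\<^sup>2)"
      using L_pos gap_nonneg[of "fst s"] by (simp add: algebra_simps)
    finally have "real (Suc n) powr q * gap (fst s - snd s)
        \<le> real (Suc n) powr q * ((2 + L) * (gap (fst s) + (norm (snd s))\<^sup>2))"
      by (intro mult_left_mono) auto
    then show ?thesis
      by (simp add: energy_def mult_ac)
  qed
  moreover have "real (Suc n) powr q * (norm (snd s))\<^sup>2 \<le> (2 + L) * energy n s" for n s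
  proof -
    have "(norm (snd s))\<^sup>2 \<le> (2 + L) * (gap (fst s) + (norm (snd s))\<^sup>2)"
      using L_pos gap_nonneg[of "fst s"] by (simp add: algebra_simps)
    then have "real (Suc n) powr q * (norm (snd s))\<^sup>2
        \<le> real (Suc n) powr q * ((2 + L) * (gap (fst s) + (norm (snd s))\<^sup>2))"
      by (intro mult_left_mono) auto
    then show ?thesis
      by (simp add: energy_def mult_ac)
  qed
  moreover have "(2 + L) * energy n (S n \<omega>) \<le> (2 + L) * E" for n
    using E L_pos by (intro mult_left_mono) auto
  ultimately show ?thesis
    by (intro that[of "(2 + L) * E"]) (meson order_trans)+
qed

lemma tendsto_zero_if_rate:
  fixes v :: "nat \<Rightarrow> real"
  assumes "\<And>n. 0 \<le> v n" "\<And>n. real (Suc n) powr q * v n \<le> K"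
  shows "v \<longlonglongrightarrow> 0"
proof (rule tendsto_sandwich[of "\<lambda>_. 0" _ _ "\<lambda>n. K * real (Suc n) powr - q"])
  have "filterlim (\<lambda>n. real (Suc n)) at_top sequentially"
    using filterlim_compose[OF filterlim_real_sequentially filterlim_Suc] .
  then have "(\<lambda>n. real (Suc n) powr - q) \<longlonglongrightarrow> 0"
    using rate by (intro tendsto_neg_powr) auto
  then show "(\<lambda>n. K * real (Suc n) powr - q) \<longlonglongrightarrow> 0"
    by (rule tendsto_mult_right_zero)
  show "\<forall>\<^sub>F n in sequentially. v n \<le> K * real (Suc n) powr - q"
    using assms(2) by (intro always_eventually allI) (simp add: powr_minus field_simps)
qed (use assms in auto)

text \<open>The rate forces gap and momentum to 0. Convergence of the Lyapunov values therefore
  reduces to convergence of the distances from the auxiliary sequence to \<open>y\<close>, cluster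
  points are minimizers by continuity, and the iterates inherit the limit.\<close>

lemma path_convergent:
  assumes energy: "convergent (\<lambda>n. energy n (S n \<omega>))"
    and D: "D \<noteq> {}" "D \<subseteq> {y. f y = min_value f}" "{y. f y = min_value f} \<subseteq> closure D"
    and lyapunov: "\<And>y. y \<in> D \<Longrightarrow> convergent (\<lambda>n. lyapunov y (S n \<omega>))"
  shows "\<exists>l. f l = min_value f \<and> (\<lambda>n. fst (S n \<omega>) - snd (S n \<omega>)) \<longlonglongrightarrow> l"
proof -
  obtain K where K: "\<And>n. real (Suc n) powr q * gap (fst (S n \<omega>) - snd (S n \<omega>)) \<le> K"
    "\<And>n. real (Suc n) powr q * (norm (snd (S n \<omega>)))\<^sup>2 \<le> K"
    using path_rate[OF energy] by blast
  have gap0: "(\<lambda>n. gap (fst (S n \<omega>) - snd (S n \<omega>))) \<longlonglongrightarrow> 0"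
    by (rule tendsto_zero_if_rate[OF gap_nonneg K(1)])
  have p2: "(\<lambda>n. (norm (snd (S n \<omega>)))\<^sup>2) \<longlonglongrightarrow> 0"
    by (rule tendsto_zero_if_rate[OF _ K(2)]) simp
  then have p: "(\<lambda>n. snd (S n \<omega>)) \<longlonglongrightarrow> 0"
    using tendsto_real_sqrt[OF p2] by (simp add: tendsto_norm_zero_iff)
  have "\<exists>l\<in>{y. f y = min_value f}. (\<lambda>n. fst (S n \<omega>)) \<longlonglongrightarrow> l"
  proof (rule Opial_convergence[OF D])
    fix y assume "y \<in> D"
    then obtain d where d: "(\<lambda>n. lyapunov y (S n \<omega>)) \<longlonglongrightarrow> d"
      using lyapunov by (auto simp: convergent_def)
    have "(\<lambda>n. lyapunov y (S n \<omega>) - (\<kappa>\<^sup>2 + \<kappa>) * (norm (snd (S n \<omega>)))\<^sup>2) \<longlonglongrightarrow> d - (\<kappa>\<^sup>2 + \<kappa>) * 0"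
      by (intro tendsto_intros d p2)
    then have "(\<lambda>n. (norm (fst (S n \<omega>) - y))\<^sup>2) \<longlonglongrightarrow> d"
      by (simp add: lyapunov_def)
    from tendsto_real_sqrt[OF this] show "convergent (\<lambda>n. norm (fst (S n \<omega>) - y))"
      by (auto simp: convergent_def)
  next
    fix r :: "nat \<Rightarrow> nat" and l
    assume r: "strict_mono r" and l: "((\<lambda>n. fst (S n \<omega>)) \<circ> r) \<longlonglongrightarrow> l"
    have "(\<lambda>n. fst (S (r n) \<omega>) - snd (S (r n) \<omega>)) \<longlonglongrightarrow> l - 0"
      using l LIMSEQ_subseq_LIMSEQ[OF p r] by (intro tendsto_diff) (simp_all add: comp_def)
    moreover have "isCont gap l"
      using continuous_objective[of UNIV] unfolding gap_def
      by (intro continuous_intros) (simp add: continuous_on_eq_continuous_at)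
    ultimately have "(\<lambda>n. gap (fst (S (r n) \<omega>) - snd (S (r n) \<omega>))) \<longlonglongrightarrow> gap l"
      using isCont_tendsto_compose[of l gap] by simp
    moreover have "(\<lambda>n. gap (fst (S (r n) \<omega>) - snd (S (r n) \<omega>))) \<longlonglongrightarrow> 0"
      using LIMSEQ_subseq_LIMSEQ[OF gap0 r] by (simp add: comp_def)
    ultimately have "gap l = 0"
      by (rule LIMSEQ_unique)
    then show "l \<in> {y. f y = min_value f}"
      by (simp add: gap_def)
  qed
  then obtain l where "f l = min_value f" "(\<lambda>n. fst (S n \<omega>)) \<longlonglongrightarrow> l"
    by blast
  with tendsto_diff[OF this(2) p] show ?thesis
    by auto
qed

theorem
  assumes x: "\<And>n \<omega>. \<omega> \<in> space M \<Longrightarrow> x (Suc n) \<omega> = fst (S n \<omega>) - snd (S n \<omega>)"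
  shows converges_to_minimizer:
      "\<exists>xlim \<in> borel_measurable M. AE \<omega> in M. (\<lambda>t. x t \<omega>) \<longlonglongrightarrow> xlim \<omega> \<and> f (xlim \<omega>) = min_value f"
    and objective_rate:
      "as_bigo M (\<lambda>t \<omega>. f (x t \<omega>) - min_value f) (\<lambda>t. 1 / real t powr q)"
proof -
  \<comment> \<open>Countability allows one null set for all \<open>y\<close> in \<open>D\<close>;
    density is what \<open>Opial_convergence\<close> asks of \<open>D\<close>.\<close>
  obtain D where D: "countable D" "D \<subseteq> {y. f y = min_value f}" "{y. f y = min_value f} \<subseteq> closure D"
    using separable[of "{y. f y = min_value f}"] by blast
  obtain y where y: "f y = min_value f"
    using minimizer_exists by blast
  with D have "D \<noteq> {}" by auto
  have energy: "AE \<omega> in M. convergent (\<lambda>n. energy n (S n \<omega>))"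
    by (rule energy_convergent[OF y])
  have lyapunov: "AE \<omega> in M. \<forall>y\<in>D. convergent (\<lambda>n. lyapunov y (S n \<omega>))"
    using D lyapunov_convergent by (subst AE_ball_countable) auto
  \<comment> \<open>A pointwise \<open>lim\<close> of measurable functions is measurable and defined
    everywhere; on the null set of divergence its value is arbitrary.\<close>
  define xlim where "xlim \<omega> = lim (\<lambda>n. fst (S n \<omega>) - snd (S n \<omega>))" for \<omega>
  have "xlim \<in> borel_measurable M"
    unfolding xlim_def by measurable
  moreover have "AE \<omega> in M. (\<lambda>t. x t \<omega>) \<longlonglongrightarrow> xlim \<omega> \<and> f (xlim \<omega>) = min_value f"
    using energy lyapunov AE_space
  proof eventually_elim
    case (elim \<omega>)
    then obtain l where l: "f l = min_value f" "(\<lambda>n. fst (S n \<omega>) - snd (S n \<omega>)) \<longlonglongrightarrow> l"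
      using path_convergent[OF elim(1) \<open>D \<noteq> {}\<close> D(2,3)] by blast
    then have "xlim \<omega> = l"
      by (simp add: xlim_def limI)
    moreover have "(\<lambda>n. x (Suc n) \<omega>) \<longlonglongrightarrow> l"
      using l(2) x[OF elim(3)] by simp
    ultimately show ?case
      using l(1) by (simp add: LIMSEQ_imp_Suc)
  qed
  ultimately show "\<exists>xlim \<in> borel_measurable M. AE \<omega> in M. (\<lambda>t. x t \<omega>) \<longlonglongrightarrow> xlim \<omega> \<and> f (xlim \<omega>) = min_value f"
    by blast
  show "as_bigo M (\<lambda>t \<omega>. f (x t \<omega>) - min_value f) (\<lambda>t. 1 / real t powr q)"
    unfolding as_bigo_def using energy AE_space
  proof eventually_elim
    case (elim \<omega>)
    then obtain K where K: "\<And>n. real (Suc n) powr q * gap (fst (S n \<omega>) - snd (S n \<omega>)) \<le> K"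
      using path_rate by blast
    have "(f (x t \<omega>) - min_value f) / (1 / real t powr q) \<le> K" if t: "1 \<le> t" for t
    proof -
      obtain n where "t = Suc n"
        using t by (cases t) auto
      then show ?thesis
        using K[of n] x[OF elim(2), of n] by (simp add: gap_def mult.commute)
    qed
    then show ?case
      by (intro bdd_aboveI2) auto
  qed
qed

end

section \<open>Reduction of the three methods to the momentum recursion\<close>

text \<open>The index shift goes through the disjoint one-element blocks \<open>{Suc n}\<close>,
  from which the single coordinate is projected.\<close>

lemma (in prob_space) indep_vars_Suc:
  assumes "indep_vars (\<lambda>_. N) X {1..}"
  shows "indep_vars (\<lambda>_. N) (\<lambda>n. X (Suc n)) UNIV"
proof -
  have "indep_vars (\<lambda>n. PiM {Suc n} (\<lambda>_. N)) (\<lambda>n \<omega>. restrict (\<lambda>i. X i \<omega>) {Suc n}) UNIV"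
    by (rule indep_vars_restrict[OF assms]) (auto simp: disjoint_family_on_def)
  then have "indep_vars (\<lambda>_. N) (\<lambda>n \<omega>. (\<lambda>g. g (Suc n)) (restrict (\<lambda>i. X i \<omega>) {Suc n})) UNIV"
    by (rule indep_vars_compose2) measurable
  then show ?thesis by simp
qed

text \<open>The auxiliary point is where the iterate would come to rest if all later gradients
  vanished: the remaining displacement is a geometric series with sum
  \<open>\<beta> / (1 - \<beta>)\<close> times the current velocity. Only gradients move this
  point.\<close>

lemma momentum_representation:
  fixes M :: "'w measure" and G :: "'a::euclidean_space \<Rightarrow> 'b \<Rightarrow> 'a"
  assumes beta: "0 \<le> \<beta>" "\<beta> < 1" and iterates: "sgd M G \<xi>s \<alpha> x \<or> shb M G \<xi>s \<alpha> \<beta> x \<or> snag M G \<xi>s \<alpha> \<beta> x"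
  obtains \<beta>' c :: real and S :: "nat \<Rightarrow> 'w \<Rightarrow> 'a \<times> 'a" where "0 \<le> \<beta>'" "\<beta>' < 1"
    and "\<exists>s. \<forall>\<omega>\<in>space M. S 0 \<omega> = s"
    and "\<And>n \<omega>. \<omega> \<in> space M \<Longrightarrow> S (Suc n) \<omega> =
      (fst (S n \<omega>) - (\<alpha> (Suc n) / (1 - \<beta>')) *\<^sub>R G (fst (S n \<omega>) - snd (S n \<omega>)) (\<xi>s (Suc n) \<omega>),
       \<beta>' *\<^sub>R snd (S n \<omega>) - (c * \<alpha> (Suc n)) *\<^sub>R G (fst (S n \<omega>) - snd (S n \<omega>)) (\<xi>s (Suc n) \<omega>))"
    and "\<And>n \<omega>. x (Suc n) \<omega> = fst (S n \<omega>) - snd (S n \<omega>)"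
proof -
  define k where "k = \<beta> / (1 - \<beta>)"
  have k: "k * \<beta> = k - \<beta>" "1 / (1 - \<beta>) = 1 + k"
    using beta by (auto simp: k_def field_simps)
  \<comment> \<open>Splits the step of the auxiliary point into the direct move of the iterate and
    the change of its expected later displacement.\<close>
  have kg: "(a / (1 - \<beta>)) *\<^sub>R g = a *\<^sub>R g + (k * a) *\<^sub>R g" for a and g :: 'a
  proof -
    have "a / (1 - \<beta>) = a * (1 / (1 - \<beta>))"
      by simp
    also have "\<dots> = a + k * a"
      unfolding k(2) by (simp add: algebra_simps)
    finally show ?thesis
      by (simp add: scaleR_left_distrib)
  qed
  consider "sgd M G \<xi>s \<alpha> x" | "shb M G \<xi>s \<alpha> \<beta> x" | "snag M G \<xi>s \<alpha> \<beta> x"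
    using iterates by blast
  then show ?thesis
  proof cases
    case 1
    then obtain a where a: "\<And>\<omega>. \<omega> \<in> space M \<Longrightarrow> x 1 \<omega> = a"
      and step: "\<And>n \<omega>. \<omega> \<in> space M \<Longrightarrow> x (Suc (Suc n)) \<omega> = x (Suc n) \<omega> - \<alpha> (Suc n) *\<^sub>R G (x (Suc n) \<omega>) (\<xi>s (Suc n) \<omega>)"
      unfolding sgd_def by fastforce
    show ?thesis
      \<comment> \<open>No velocity: the second component is constantly 0, with both momentum
        parameters set to 0.\<close>
      by (rule that[of 0 "\<lambda>n \<omega>. (x (Suc n) \<omega>, 0)" 0]) (use a step in auto)
  next
    case 2
    then obtain a b where ab: "\<And>\<omega>. \<omega> \<in> space M \<Longrightarrow> x 0 \<omega> = a" "\<And>\<omega>. \<omega> \<in> space M \<Longrightarrow> x 1 \<omega> = b"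
      and step: "\<And>n \<omega>. \<omega> \<in> space M \<Longrightarrow> x (Suc (Suc n)) \<omega> =
        x (Suc n) \<omega> - \<alpha> (Suc n) *\<^sub>R G (x (Suc n) \<omega>) (\<xi>s (Suc n) \<omega>) + \<beta> *\<^sub>R (x (Suc n) \<omega> - x n \<omega>)"
      unfolding shb_def by fastforce
    \<comment> \<open>The velocity of SHB is its last displacement. At \<open>n = 0\<close> it is
      formed from the two initial points, so the initial state is deterministic.\<close>
    define d where "d n \<omega> = x (Suc n) \<omega> - x n \<omega>" for n \<omega>
    have d: "d (Suc n) \<omega> = \<beta> *\<^sub>R d n \<omega> - \<alpha> (Suc n) *\<^sub>R G (x (Suc n) \<omega>) (\<xi>s (Suc n) \<omega>)" if "\<omega> \<in> space M" for n \<omega>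
      using step[OF that, of n] by (simp add: d_def)
    have x: "x (Suc (Suc n)) \<omega> = x (Suc n) \<omega> + d (Suc n) \<omega>" for n \<omega>
      by (simp add: d_def)
    show ?thesis
    proof (rule that[of \<beta> "\<lambda>n \<omega>. (x (Suc n) \<omega> + k *\<^sub>R d n \<omega>, k *\<^sub>R d n \<omega>)" k])
      show "\<exists>s. \<forall>\<omega>\<in>space M. (x (Suc 0) \<omega> + k *\<^sub>R d 0 \<omega>, k *\<^sub>R d 0 \<omega>) = s"
        using ab by (simp add: d_def)
      fix n \<omega> assume \<omega>: "\<omega> \<in> space M"
      have "k *\<^sub>R \<beta> *\<^sub>R d n \<omega> = k *\<^sub>R d n \<omega> - \<beta> *\<^sub>R d n \<omega>"
        using k(1) by (simp add: scaleR_left_diff_distrib)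
      then show "(x (Suc (Suc n)) \<omega> + k *\<^sub>R d (Suc n) \<omega>, k *\<^sub>R d (Suc n) \<omega>) =
        (fst (x (Suc n) \<omega> + k *\<^sub>R d n \<omega>, k *\<^sub>R d n \<omega>) - (\<alpha> (Suc n) / (1 - \<beta>)) *\<^sub>R
           G (fst (x (Suc n) \<omega> + k *\<^sub>R d n \<omega>, k *\<^sub>R d n \<omega>) - snd (x (Suc n) \<omega> + k *\<^sub>R d n \<omega>, k *\<^sub>R d n \<omega>)) (\<xi>s (Suc n) \<omega>),
         \<beta> *\<^sub>R snd (x (Suc n) \<omega> + k *\<^sub>R d n \<omega>, k *\<^sub>R d n \<omega>) - (k * \<alpha> (Suc n)) *\<^sub>R
           G (fst (x (Suc n) \<omega> + k *\<^sub>R d n \<omega>, k *\<^sub>R d n \<omega>) - snd (x (Suc n) \<omega> + k *\<^sub>R d n \<omega>, k *\<^sub>R d n \<omega>)) (\<xi>s (Suc n) \<omega>))"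
        unfolding x d[OF \<omega>] kg by (simp add: scaleR_right_diff_distrib mult.commute[of \<beta> k])
    qed (use beta in auto)
  next
    case 3
    then obtain y where y: "\<exists>a. \<forall>\<omega>\<in>space M. x 1 \<omega> = a" "\<exists>a. \<forall>\<omega>\<in>space M. y 1 \<omega> = a"
      and run: "\<forall>t\<ge>1. \<forall>\<omega>\<in>space M. y (t + 1) \<omega> = x t \<omega> - \<alpha> t *\<^sub>R G (x t \<omega>) (\<xi>s t \<omega>) \<and>
           x (t + 1) \<omega> = y (t + 1) \<omega> + \<beta> *\<^sub>R (y (t + 1) \<omega> - y t \<omega>)"
      unfolding snag_def by blast
    obtain a b where ab: "\<And>\<omega>. \<omega> \<in> space M \<Longrightarrow> x 1 \<omega> = a" "\<And>\<omega>. \<omega> \<in> space M \<Longrightarrow> y 1 \<omega> = b"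
      using y by blast
    have step: "y (Suc (Suc n)) \<omega> = x (Suc n) \<omega> - \<alpha> (Suc n) *\<^sub>R G (x (Suc n) \<omega>) (\<xi>s (Suc n) \<omega>)"
      "x (Suc (Suc n)) \<omega> = y (Suc (Suc n)) \<omega> + \<beta> *\<^sub>R (y (Suc (Suc n)) \<omega> - y (Suc n) \<omega>)"
      if "\<omega> \<in> space M" for n \<omega>
      using run[rule_format, of "Suc n" \<omega>] that by simp_all
    \<comment> \<open>The velocity of SNAG is the last extrapolation. The gradient enters it with
      the extra factor \<open>\<beta>\<close>, which explains the coefficient
      \<open>k * \<beta>\<close> below.\<close>
    define e where "e n \<omega> = x (Suc n) \<omega> - y (Suc n) \<omega>" for n \<omega>
    have e: "e (Suc n) \<omega> = \<beta> *\<^sub>R e n \<omega> - (\<beta> * \<alpha> (Suc n)) *\<^sub>R G (x (Suc n) \<omega>) (\<xi>s (Suc n) \<omega>)" if "\<omega> \<in> space M" for n \<omega>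
    proof -
      have "e (Suc n) \<omega> = \<beta> *\<^sub>R (y (Suc (Suc n)) \<omega> - y (Suc n) \<omega>)"
        using step(2)[OF that, of n] by (simp add: e_def)
      then show ?thesis
        unfolding step(1)[OF that] by (simp add: e_def algebra_simps)
    qed
    have x: "x (Suc (Suc n)) \<omega> = x (Suc n) \<omega> - \<alpha> (Suc n) *\<^sub>R G (x (Suc n) \<omega>) (\<xi>s (Suc n) \<omega>) + e (Suc n) \<omega>"
      if "\<omega> \<in> space M" for n \<omega>
      using step(1)[OF that, of n] by (simp add: e_def)
    show ?thesis
    proof (rule that[of \<beta> "\<lambda>n \<omega>. (x (Suc n) \<omega> + k *\<^sub>R e n \<omega>, k *\<^sub>R e n \<omega>)" "k * \<beta>"])
      show "\<exists>s. \<forall>\<omega>\<in>space M. (x (Suc 0) \<omega> + k *\<^sub>R e 0 \<omega>, k *\<^sub>R e 0 \<omega>) = s"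
        using ab by (simp add: e_def)
      fix n \<omega> assume \<omega>: "\<omega> \<in> space M"
      have "k *\<^sub>R \<beta> *\<^sub>R v = k *\<^sub>R v - \<beta> *\<^sub>R v" for v :: 'a
        using k(1) by (simp add: scaleR_left_diff_distrib)
      from this[of "e n \<omega>"] this[of "\<alpha> (Suc n) *\<^sub>R G (x (Suc n) \<omega>) (\<xi>s (Suc n) \<omega>)"]
      show "(x (Suc (Suc n)) \<omega> + k *\<^sub>R e (Suc n) \<omega>, k *\<^sub>R e (Suc n) \<omega>) =
        (fst (x (Suc n) \<omega> + k *\<^sub>R e n \<omega>, k *\<^sub>R e n \<omega>) - (\<alpha> (Suc n) / (1 - \<beta>)) *\<^sub>R
           G (fst (x (Suc n) \<omega> + k *\<^sub>R e n \<omega>, k *\<^sub>R e n \<omega>) - snd (x (Suc n) \<omega> + k *\<^sub>R e n \<omega>, k *\<^sub>R e n \<omega>)) (\<xi>s (Suc n) \<omega>),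
         \<beta> *\<^sub>R snd (x (Suc n) \<omega> + k *\<^sub>R e n \<omega>, k *\<^sub>R e n \<omega>) - (k * \<beta> * \<alpha> (Suc n)) *\<^sub>R
           G (fst (x (Suc n) \<omega> + k *\<^sub>R e n \<omega>, k *\<^sub>R e n \<omega>) - snd (x (Suc n) \<omega> + k *\<^sub>R e n \<omega>, k *\<^sub>R e n \<omega>)) (\<xi>s (Suc n) \<omega>))"
        unfolding x[OF \<omega>] e[OF \<omega>] kg by (simp add: scaleR_right_diff_distrib mult_ac)
    qed (use beta in auto)
  qed
qed

theorem theorem12:
  fixes M :: "'w measure" and N :: "'b measure"
    and f :: "'a::euclidean_space \<Rightarrow> real" and gradf :: "'a \<Rightarrow> 'a"
    and G :: "'a \<Rightarrow> 'b \<Rightarrow> 'a"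
    and \<xi> :: "'w \<Rightarrow> 'b" and \<xi>s :: "nat \<Rightarrow> 'w \<Rightarrow> 'b"
    and \<alpha> :: "nat \<Rightarrow> real" and x :: "nat \<Rightarrow> 'w \<Rightarrow> 'a"
    and A B C L \<epsilon> \<beta> :: real
  assumes M: "prob_space M"
    and gradient: "\<And>z. GDERIV f z :> gradf z"
    and continuous_gradient: "continuous_on UNIV gradf"
    and convex: "convex_on UNIV f"
    and smooth: "\<And>z w. norm (gradf z - gradf w) \<le> L * norm (z - w)"
    and minimizer: "\<exists>z. \<forall>w. f z \<le> f w"
    and random_element: "\<xi> \<in> M \<rightarrow>\<^sub>M N"
    and G_measurable: "(\<lambda>(z, u). G z u) \<in> borel_measurable (borel \<Otimes>\<^sub>M N)"
    and G_integrable: "\<And>z. integrable M (\<lambda>\<omega>. G z (\<xi> \<omega>))"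
    and unbiased: "\<And>z. (\<integral>\<omega>. G z (\<xi> \<omega>) \<partial>M) = gradf z"
    and constants: "0 \<le> A" "0 \<le> B" "0 \<le> C"
    and second_moment_finite: "\<And>z. integrable M (\<lambda>\<omega>. (norm (G z (\<xi> \<omega>)))\<^sup>2)"
    and second_moment: "\<And>z. (\<integral>\<omega>. (norm (G z (\<xi> \<omega>)))\<^sup>2 \<partial>M)
                              \<le> A * (f z - min_value f) + B * (norm (gradf z))\<^sup>2 + C"
    and samples_indep: "prob_space.indep_vars M (\<lambda>_. N) \<xi>s {1..}"
    and samples_law: "\<And>t. 1 \<le> t \<Longrightarrow> distr M N (\<xi>s t) = distr M N \<xi>"
    and eps: "0 < \<epsilon>" "\<epsilon> < 1 / 3"
    and step_sizes: "theta_power \<alpha> (2 / 3 + \<epsilon>)"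
    and beta: "0 \<le> \<beta>" "\<beta> < 1"
    and iterates: "sgd M G \<xi>s \<alpha> x \<or> shb M G \<xi>s \<alpha> \<beta> x \<or> snag M G \<xi>s \<alpha> \<beta> x"
  shows "(\<exists>xlim \<in> borel_measurable M. AE \<omega> in M.
            (\<lambda>t. x t \<omega>) \<longlonglongrightarrow> xlim \<omega> \<and> f (xlim \<omega>) = min_value f) \<and>
         as_bigo M (\<lambda>t \<omega>. f (x t \<omega>) - min_value f) (\<lambda>t. 1 / real t powr (1 / 3 - \<epsilon>))"
proof -
  interpret prob_space M by (rule M)
  obtain \<eta>\<^sub>1 \<eta>\<^sub>2 where \<eta>: "0 < \<eta>\<^sub>1" "0 < \<eta>\<^sub>2"
    and steps: "\<And>t. 1 \<le> t \<Longrightarrow> \<eta>\<^sub>1 * real t powr - (2 / 3 + \<epsilon>) \<le> \<alpha> t \<and> \<alpha> t \<le> \<eta>\<^sub>2 * real t powr - (2 / 3 + \<epsilon>)"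
    using step_sizes unfolding theta_power_def by blast
  obtain \<beta>' c S where S: "0 \<le> \<beta>'" "\<beta>' < 1" "\<exists>s. \<forall>\<omega>\<in>space M. S 0 \<omega> = s"
    "\<And>n \<omega>. \<omega> \<in> space M \<Longrightarrow> S (Suc n) \<omega> =
      (fst (S n \<omega>) - (\<alpha> (Suc n) / (1 - \<beta>')) *\<^sub>R G (fst (S n \<omega>) - snd (S n \<omega>)) (\<xi>s (Suc n) \<omega>),
       \<beta>' *\<^sub>R snd (S n \<omega>) - (c * \<alpha> (Suc n)) *\<^sub>R G (fst (S n \<omega>) - snd (S n \<omega>)) (\<xi>s (Suc n) \<omega>))"
    and x: "\<And>n \<omega>. x (Suc n) \<omega> = fst (S n \<omega>) - snd (S n \<omega>)"
    using momentum_representation[OF beta iterates] by metis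
  \<comment> \<open>A strictly positive Lipschitz constant is required by
    \<open>smooth_convex\<close>, whereas \<open>L\<close> itself may be 0.\<close>
  have "norm (gradf z - gradf w) \<le> max L 1 * norm (z - w)" for z w
    using smooth[of z w] mult_right_mono[of L "max L 1" "norm (z - w)"] by simp
  then interpret smooth_convex f gradf "max L 1"
    using gradient convex minimizer by unfold_locales auto
  \<comment> \<open>With \<open>q = 1 / 3 - \<epsilon>\<close> the step sizes are of order
    \<open>t\<close> to the power \<open>q - 1\<close>.\<close>
  have q: "1 / 3 - \<epsilon> - 1 = - (2 / 3 + \<epsilon>)" by simp
  interpret stochastic_momentum M f gradf "max L 1" N G \<xi> "\<lambda>n. \<xi>s (Suc n)" "\<lambda>n. \<alpha> (Suc n)"
    A B C \<beta>' c \<eta>\<^sub>1 \<eta>\<^sub>2 "1 / 3 - \<epsilon>" S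
  proof unfold_locales
    show "(\<integral>\<omega>. (norm (G z (\<xi> \<omega>)))\<^sup>2 \<partial>M) \<le> A * gap z + B * (norm (gradf z))\<^sup>2 + C" for z
      using second_moment by (simp add: gap_def)
    show "\<eta>\<^sub>1 * real (Suc n) powr (1 / 3 - \<epsilon> - 1) \<le> \<alpha> (Suc n)" "\<alpha> (Suc n) \<le> \<eta>\<^sub>2 * real (Suc n) powr (1 / 3 - \<epsilon> - 1)" for n
      using steps[of "Suc n"] unfolding q by auto
    show "indep_vars (\<lambda>_. N) (\<lambda>n. \<xi>s (Suc n)) UNIV"
      by (rule indep_vars_Suc[OF samples_indep])
  qed (fact random_element G_measurable G_integrable unbiased constants second_moment_finite S \<eta>
      | use eps samples_law in simp)+
  show ?thesis
    using converges_to_minimizer[of x] objective_rate[of x] x by blast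
qed

end
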